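(* Let $d\ge 2$ and $\gamma>-\tfrac12$. For every $n=0,1,2,\ldots$, every $u\in \mathcal V_n^E(\mathbb V_0^{d+1},(1-t^2)^{\gamma-\frac12})$ satisfies $$\Big[(1-t^2)\partial_t^2-(2\gamma+d)\,t\,\partial_t+\frac{d-1}{t}\partial_t+\frac1{t^2}\Delta_0^{(x)}\Big]u=-n(n+2\gamma+d-1)\,u .$$ Furthermore, every $u\in \mathcal V_n^O(\mathbb V_0^{d+1},|t|^{-2}(1-t^2)^{\gamma-\frac12})$ satisfies $$\Big[(1-t^2)\partial_t^2-(2\gamma+d-2)\,t\,\partial_t+\frac{d-3}{t}\Big(\partial_t-\frac1t\Big)+\frac1{t^2}\Delta_0^{(x)}\Big]u=-n(n+2\gamma+d-3)\,u .$$
   Context: $\mathbb V_0^{d+1}=\{(x,t)\in\mathbb R^d\times\mathbb R:\ \|x\|=|t|,\ -1\le t\le 1\}$ is the finite double cone. Integration over it means $\int_{\mathbb V_0^{d+1}} f\,d\sigma=\int_{-1}^1|t|^{d-1}\int_{\mathbb S^{d-1}}f(|t|\xi,t)\,d\sigma(\xi)\,dt$, with $d\sigma(\xi)$ the surface measure of the unit sphere $\mathbb S^{d-1}$. Polynomials are polynomials in $(x,t)$ restricted to $\mathbb V_0^{d+1}$. A function $u$ is even (resp. odd) in $t$ if $u(x,-t)=u(x,t)$ (resp. $u(x,-t)=-u(x,t)$) on $\mathbb V_0^{d+1}$. For an even weight $w$ put $\langle f,g\rangle_w=\int_{\mathbb V_0^{d+1}}f\,g\,w(t)\,d\sigma(x,t)$.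 $\mathcal V_n^E(\mathbb V_0^{d+1},w)$ (resp. $\mathcal V_n^O(\mathbb V_0^{d+1},w)$) is the space of polynomials of degree at most $n$ that are even (resp. odd) in $t$ and are orthogonal with respect to $\langle\cdot,\cdot\rangle_w$ to all polynomials of degree at most $n-1$ that are even (resp. odd) in $t$. (When $w$ is integrable, orthogonality to polynomials of the other parity is automatic. For $w=|t|^{-2}(1-t^2)^{\gamma-\frac12}$ the form is used only on functions odd in $t$, where it is finite.) The differential operators are understood in the coordinates $(\xi,t)$, $x=|t|\xi$, $\xi\in\mathbb S^{d-1}$, $t\ne0$: $\partial_t$ is the derivative in $t$ with $\xi$ fixed, and $\Delta_0^{(x)}$ is the Laplace–Beltrami operator of $\mathbb S^{d-1}$ acting on $\xi$. *)

theory Defs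
  imports "HOL-Analysis.Analysis"
begin

text \<open>
  The ambient space R^d is \<^typ>\<open>real ^ 'n\<close> with d = CARD('n).  Functions on the double cone are
  represented by total functions on \<^typ>\<open>(real ^ 'n) \<times> real\<close>; every notion below depends only on
  their values on the cone.
\<close>

definition double_cone :: "((real ^ 'n) \<times> real) set" where
  "double_cone = {(x, t). norm x = \<bar>t\<bar> \<and> -1 \<le> t \<and> t \<le> 1}"


subsection \<open>Integration\<close>

text \<open>
  Surface measure of the unit sphere, characterised by polar coordinates: the surface measure of a
  Borel set A in the sphere is d times the volume of the part of the unit ball lying over A.
\<close>

definition surface_measure :: "(real ^ 'n) measure" where
  "surface_measure = scale_measure (of_nat CARD('n))
     (distr (restrict_space lborel (ball 0 1 - {0})) (restrict_space borel (sphere 0 1)) sgn)"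

definition cone_integral :: "((real ^ 'n) \<times> real \<Rightarrow> real) \<Rightarrow> real" where
  "cone_integral f = (LINT t:{-1..1}|lborel. \<bar>t\<bar> ^ (CARD('n) - 1) *
     (LINT \<xi>|(surface_measure :: (real ^ 'n) measure). f (\<bar>t\<bar> *\<^sub>R \<xi>, t)))"

definition cone_inner ::
  "(real \<Rightarrow> real) \<Rightarrow> ((real ^ 'n) \<times> real \<Rightarrow> real) \<Rightarrow> ((real ^ 'n) \<times> real \<Rightarrow> real) \<Rightarrow> real" where
  "cone_inner w f g = cone_integral (\<lambda>(x, t). f (x, t) * g (x, t) * w t)"


subsection \<open>Polynomials on the double cone\<close>

definition polynomial_of_degree_le :: "nat \<Rightarrow> ((real ^ 'n) \<times> real \<Rightarrow> real) \<Rightarrow> bool" where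
  "polynomial_of_degree_le n p \<longleftrightarrow>
     (\<exists>c :: ('n \<Rightarrow> nat) \<Rightarrow> nat \<Rightarrow> real. \<forall>x t.
        p (x, t) = (\<Sum>(\<alpha>, k) \<in> {(\<alpha>, k). (\<Sum>i\<in>UNIV. \<alpha> i) + k \<le> n}.
                      c \<alpha> k * (\<Prod>i\<in>UNIV. (x $ i) ^ \<alpha> i) * t ^ k))"

definition cone_polys :: "nat \<Rightarrow> ((real ^ 'n) \<times> real \<Rightarrow> real) set" where
  "cone_polys n = {u. \<exists>p. polynomial_of_degree_le n p \<and> (\<forall>z\<in>double_cone. u z = p z)}"

definition even_in_t :: "((real ^ 'n) \<times> real \<Rightarrow> real) \<Rightarrow> bool" where
  "even_in_t u \<longleftrightarrow> (\<forall>(x, t)\<in>double_cone. u (x, - t) = u (x, t))"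

definition odd_in_t :: "((real ^ 'n) \<times> real \<Rightarrow> real) \<Rightarrow> bool" where
  "odd_in_t u \<longleftrightarrow> (\<forall>(x, t)\<in>double_cone. u (x, - t) = - u (x, t))"

text \<open>
  Degree at most n - 1 is expressed as degree at most m for some m < n, so that for n = 0 there is
  no orthogonality condition (the only polynomial of degree at most -1 is 0).
\<close>

definition V_even :: "nat \<Rightarrow> (real \<Rightarrow> real) \<Rightarrow> ((real ^ 'n) \<times> real \<Rightarrow> real) set" where
  "V_even n w = {u \<in> cone_polys n. even_in_t u \<and>
     (\<forall>m<n. \<forall>q\<in>cone_polys m. even_in_t q \<longrightarrow> cone_inner w u q = 0)}"

definition V_odd :: "nat \<Rightarrow> (real \<Rightarrow> real) \<Rightarrow> ((real ^ 'n) \<times> real \<Rightarrow> real) set" where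
  "V_odd n w = {u \<in> cone_polys n. odd_in_t u \<and>
     (\<forall>m<n. \<forall>q\<in>cone_polys m. odd_in_t q \<longrightarrow> cone_inner w u q = 0)}"


subsection \<open>Differential operators in the coordinates (xi, t)\<close>

definition cone_coords :: "((real ^ 'n) \<times> real \<Rightarrow> real) \<Rightarrow> real ^ 'n \<Rightarrow> real \<Rightarrow> real" where
  "cone_coords u \<xi> t = u (\<bar>t\<bar> *\<^sub>R \<xi>, t)"

text \<open>The derivative is taken within [-1, 1], hence it is one-sided at the two rims of the cone.\<close>

definition d_dt :: "(real ^ 'n \<Rightarrow> real \<Rightarrow> real) \<Rightarrow> real ^ 'n \<Rightarrow> real \<Rightarrow> real" where
  "d_dt g \<xi> t = vector_derivative (g \<xi>) (at t within {-1..1})"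

definition laplacian :: "(real ^ 'n \<Rightarrow> real) \<Rightarrow> real ^ 'n \<Rightarrow> real" where
  "laplacian F y = (\<Sum>b\<in>Basis. (deriv ^^ 2) (\<lambda>s. F (y + s *\<^sub>R b)) 0)"

text \<open>
  The Laplace--Beltrami operator of the unit sphere: the Euclidean Laplacian, at points of the
  sphere, of the extension y \<mapsto> f(y/|y|) that is constant along rays (\<^term>\<open>sgn y\<close> is y/|y|).
\<close>

definition laplace_beltrami :: "(real ^ 'n \<Rightarrow> real) \<Rightarrow> real ^ 'n \<Rightarrow> real" where
  "laplace_beltrami f \<xi> = laplacian (\<lambda>y. f (sgn y)) \<xi>"


subsection \<open>Sanity checks\<close>

lemma finite_exponents:
  "finite {(\<alpha> :: 'n::finite \<Rightarrow> nat, k :: nat). (\<Sum>i\<in>UNIV. \<alpha> i) + k \<le> n}"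
proof (rule finite_subset)
  have "\<alpha> i \<le> n" if "(\<Sum>i\<in>UNIV. \<alpha> i) + k \<le> n" for \<alpha> :: "'n \<Rightarrow> nat" and k i
    using member_le_sum[of i UNIV \<alpha>] that by simp
  then show "{(\<alpha> :: 'n \<Rightarrow> nat, k :: nat). (\<Sum>i\<in>UNIV. \<alpha> i) + k \<le> n}
      \<subseteq> (UNIV \<rightarrow>\<^sub>E {..n}) \<times> {..n}"
    by auto
  show "finite (((UNIV :: 'n set) \<rightarrow>\<^sub>E {..n}) \<times> {..n})"
    by (intro finite_cartesian_product finite_PiE) auto
qed

lemma space_surface_measure [simp]:
  "space (surface_measure :: (real ^ 'n) measure) = sphere 0 1"
  by (simp add: surface_measure_def space_scale_measure space_restrict_space)

lemma sets_surface_measure [simp]: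
  "sets (surface_measure :: (real ^ 'n) measure) = sets (restrict_space borel (sphere 0 1))"
  by (simp add: surface_measure_def)

lemma sgn_measurable_sphere:
  "sgn \<in> restrict_space lborel (ball 0 1 - {0 :: real ^ 'n}) \<rightarrow>\<^sub>M restrict_space borel (sphere 0 1)"
proof (rule measurable_restrict_space2)
  show "sgn \<in> space (restrict_space lborel (ball 0 1 - {0 :: real ^ 'n})) \<rightarrow> sphere 0 1"
    by (auto simp: norm_sgn space_restrict_space)
  have "(\<lambda>x :: real ^ 'n. inverse (norm x) *\<^sub>R x) \<in> borel_measurable lborel"
    by measurable
  then have "(sgn :: real ^ 'n \<Rightarrow> _) \<in> borel_measurable lborel"
    by (simp add: sgn_div_norm[abs_def])
  then show "sgn \<in> restrict_space lborel (ball 0 1 - {0 :: real ^ 'n}) \<rightarrow>\<^sub>M borel"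
    by (rule measurable_restrict_space1)
qed

lemma emeasure_surface_measure:
  fixes A :: "(real ^ 'n) set"
  assumes "A \<in> sets borel" "A \<subseteq> sphere 0 1"
  shows "emeasure surface_measure A =
    of_nat CARD('n) * emeasure lborel {x. x \<noteq> 0 \<and> norm x < 1 \<and> sgn x \<in> A}"
proof -
  have A: "A \<in> sets (restrict_space borel (sphere 0 1))"
    using assms by (simp add: sets_restrict_space_iff)
  let ?P = "{x :: real ^ 'n. x \<noteq> 0 \<and> norm x < 1 \<and> sgn x \<in> A}"
  have *: "sgn -` A \<inter> space (restrict_space lborel (ball 0 1 - {0})) = ?P"
    by (auto simp: space_restrict_space)
  have "emeasure (restrict_space lborel (ball 0 1 - {0})) ?P = emeasure lborel ?P"
    by (rule emeasure_restrict_space) auto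
  then show ?thesis
    unfolding surface_measure_def emeasure_scale_measure
    by (subst emeasure_distr[OF sgn_measurable_sphere A]) (simp only: *)
qed

lemma surface_measure_sphere:
  "emeasure (surface_measure :: (real ^ 'n) measure) (sphere 0 1) =
     ennreal (2 * pi powr (CARD('n) / 2) / Gamma (CARD('n) / 2))"
proof -
  let ?d = "CARD('n)"
  have "{x :: real ^ 'n. x \<noteq> 0 \<and> norm x < 1 \<and> sgn x \<in> sphere 0 1} = ball 0 1 - {0}"
    by (auto simp: norm_sgn)
  then have "emeasure (surface_measure :: (real ^ 'n) measure) (sphere 0 1) =
      of_nat ?d * emeasure lborel (ball (0 :: real ^ 'n) 1 - {0})"
    by (simp add: emeasure_surface_measure)
  also have "emeasure lborel (ball (0 :: real ^ 'n) 1 - {0}) = emeasure lborel (ball (0 :: real ^ 'n) 1)"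
    by (subst emeasure_Diff) auto
  also have "\<dots> = ennreal (unit_ball_vol (real ?d))"
    by (subst emeasure_ball) auto
  also have "of_nat ?d * ennreal (unit_ball_vol (real ?d)) = ennreal (real ?d * unit_ball_vol (real ?d))"
    by (simp add: ennreal_mult ennreal_of_nat_eq_real_of_nat)
  also have "Gamma (real ?d / 2 + 1) = real ?d / 2 * Gamma (real ?d / 2)"
  proof (rule Gamma_plus1)
    have "real ?d / 2 > 0"
      by simp
    then show "real ?d / 2 \<notin> \<int>\<^sub>\<le>\<^sub>0"
      using nonpos_Ints_nonpos by force
  qed
  then have "real ?d * unit_ball_vol (real ?d) = 2 * pi powr (?d / 2) / Gamma (?d / 2)"
    by (simp only: unit_ball_vol_def) (simp add: divide_simps)
  finally show ?thesis .
qed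

end

theory Submission
  imports Defs
begin

text \<open>
  On the cone \<open>t\<^sup>2 = |x|\<^sup>2\<close>, so a polynomial that is even in \<open>t\<close> restricts to a polynomial \<open>p(x)\<close>, and
  an odd one to \<open>t p(x)\<close> with \<open>deg p < n\<close>.  The cone integral becomes the integral over the unit ball
  with weight \<open>(1 - |x|\<^sup>2)\<close> to the power \<open>\<gamma> - 1/2\<close>; in the odd case the factor \<open>|t|\<^sup>-\<^sup>2\<close> cancels
  \<open>t\<^sup>2\<close>.  Hence \<open>p\<close> is an orthogonal polynomial of the ball, and both equations reduce to
  \<open>(\<Delta> - E\<^sup>2 - (2\<gamma> + d - 1) E) p = - m (m + 2\<gamma> + d - 1) p\<close> with \<open>E = \<langle>x, \<nabla>\<rangle>\<close> and \<open>m = n\<close> or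
  \<open>m = n - 1\<close>.  This operator preserves degrees and acts on the top homogeneous part by the eigenvalue
  up to lower order terms, so it suffices that it is symmetric.  On homogeneous polynomials \<open>u\<close>, \<open>q\<close> of
  degrees \<open>j\<close>, \<open>k\<close>, symmetry follows from Green's identity on the sphere,
  \<open>\<integral> (q \<Delta>u - u \<Delta>q) = (j - k) (j + k + d - 2) \<integral> u q\<close>, and a two-term recurrence for the radial
  moments of the weight.
\<close>

subsection \<open>Homogeneous polynomials\<close>

text \<open>\<open>hpoly k\<close> is generated by rules instead of coefficients: degrees,
  derivatives and scaling are then handled by rule induction, and the zero function is homogeneous
  of every degree. Working degree by degree separates variables, because the weighted integral of a
  homogeneous function is a radial moment times a sphere integral. This matters because for \<gamma>
  < 1/2 the weight is unbounded at the rim: no integration by parts on the ball is made against it.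
  Angular parts are integrated without weight, and the radial recurrence differentiates
  \<open>1 - t^2\<close> to the power \<gamma> + 1/2, which vanishes at the rim for every \<gamma> >
  -1/2. The symmetry is exact because the recurrence trades Green's factor
  \<open>j + k + d - 2\<close> for \<open>j + k + 2 \<gamma> + d - 1\<close>, and
  \<open>(j - k) (j + k + 2 \<gamma> + d - 1)\<close> is the difference of the eigenvalues of
  degrees \<open>j\<close> and \<open>k\<close>. Since \<open>surface_measure\<close> is defined
  through volumes, the sphere identities are extracted from integrals over the ball, where a
  homogeneous function of degree \<open>k\<close> contributes its sphere integral divided by
  \<open>d + k\<close>.\<close>

inductive hpoly :: "nat \<Rightarrow> (real ^ 'n \<Rightarrow> real) \<Rightarrow> bool" where
  const: "hpoly 0 (\<lambda>_. c)"
| coord: "hpoly k f \<Longrightarrow> hpoly (Suc k) (\<lambda>x. x $ i * f x)"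
| add: "hpoly k f \<Longrightarrow> hpoly k g \<Longrightarrow> hpoly k (\<lambda>x. f x + g x)"

lemma hpoly_scale: "hpoly k f \<Longrightarrow> hpoly k (\<lambda>x. c * f x)"
proof (induction rule: hpoly.induct)
  case (coord k f i)
  then show ?case
    using hpoly.coord[of k "\<lambda>x. c * f x" i] by (simp add: ac_simps)
qed (auto simp: distrib_left intro: hpoly.intros)

lemma hpoly_zero: "hpoly k (\<lambda>_. 0)"
proof (induction k)
  case (Suc k)
  then show ?case
    using hpoly.coord[of k "\<lambda>_. 0"] by simp
qed (rule hpoly.const)

lemma hpoly_sum: "(\<And>i. i \<in> A \<Longrightarrow> hpoly k (f i)) \<Longrightarrow> hpoly k (\<lambda>x. \<Sum>i\<in>A. f i x)"
  by (induction A rule: infinite_finite_induct) (auto intro: hpoly_zero hpoly.add)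

lemma hpoly_mult:
  assumes "hpoly j f" "hpoly k g"
  shows "hpoly (j + k) (\<lambda>x. f x * g x)"
  using assms(1)
proof (induction rule: hpoly.induct)
  case (coord j f i)
  then show ?case
    using hpoly.coord[of "j + k" "\<lambda>x. f x * g x" i] by (simp add: ac_simps)
qed (auto simp: distrib_right intro: hpoly.intros hpoly_scale assms(2))

lemma hpoly_power: "hpoly k f \<Longrightarrow> hpoly (m * k) (\<lambda>x. f x ^ m)"
proof (induction m)
  case 0
  then show ?case using hpoly.const[of 1] by simp
next
  case (Suc m)
  then show ?case using hpoly_mult by fastforce
qed

lemma hpoly_prod:
  "(\<And>i. i \<in> A \<Longrightarrow> hpoly (k i) (f i)) \<Longrightarrow> hpoly (\<Sum>i\<in>A. k i) (\<lambda>x. \<Prod>i\<in>A. f i x)"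
proof (induction A rule: infinite_finite_induct)
  case (insert a A)
  then show ?case by (simp add: hpoly_mult)
qed (use hpoly.const[of 1] in simp_all)

lemma hpoly_nth: "hpoly 1 (\<lambda>x. x $ i)"
  using hpoly.coord[OF hpoly.const[of 1], of i] by simp

lemma norm_square_sum: "(norm (x :: real ^ 'n))\<^sup>2 = (\<Sum>i\<in>UNIV. (x $ i)\<^sup>2)"
  by (simp add: norm_vec_def L2_set_def sum_nonneg)

lemma hpoly_norm_square: "hpoly 2 (\<lambda>x :: real ^ 'n. (norm x)\<^sup>2)"
proof -
  have "hpoly 2 (\<lambda>x :: real ^ 'n. (x $ i)\<^sup>2)" for i
    using hpoly_power[OF hpoly_nth, of 2 i] by simp
  then show ?thesis
    by (simp add: norm_square_sum hpoly_sum)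
qed

lemma hpoly_scaleR: "hpoly k f \<Longrightarrow> f (r *\<^sub>R x) = r ^ k * f x"
  by (induction rule: hpoly.induct) (auto simp: algebra_simps)

lemma hpoly_continuous_on: "hpoly k f \<Longrightarrow> continuous_on A f"
  by (induction rule: hpoly.induct) (auto intro!: continuous_intros)

lemma hpoly_measurable: "hpoly k f \<Longrightarrow> f \<in> borel_measurable borel"
  by (intro borel_measurable_continuous_onI hpoly_continuous_on)

lemma hpoly_differentiable: "hpoly k f \<Longrightarrow> f differentiable at x"
proof (induction rule: hpoly.induct)
  case (coord k f i)
  have "(\<lambda>x. x $ i) differentiable at x"
    by (simp add: bounded_linear_imp_differentiable bounded_linear_vec_nth)
  then show ?case
    using coord by (intro differentiable_mult)
qed auto

section \<open>Partial derivatives, Euler's identity and the Laplacian of homogeneous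
  polynomials\<close>

definition partial :: "'n \<Rightarrow> (real ^ 'n \<Rightarrow> real) \<Rightarrow> real ^ 'n \<Rightarrow> real" where
  "partial i f x = frechet_derivative f (at x) (axis i 1)"

lemma partial_eqI: "(f has_derivative f') (at x) \<Longrightarrow> partial i f x = f' (axis i 1)"
  by (simp add: partial_def flip: frechet_derivative_at)

lemma partial_const: "partial i (\<lambda>_. c) x = 0"
  by (simp add: partial_def)

lemma partial_nth: "partial i (\<lambda>x. x $ j) x = (if i = j then 1 else 0)"
proof -
  have "((\<lambda>x. x $ j) has_derivative (\<lambda>h. h $ j)) (at x)"
    by (rule bounded_linear_imp_has_derivative[OF bounded_linear_vec_nth])
  from partial_eqI[OF this] show ?thesis
    by (simp add: axis_def)
qed

lemma partial_add:
  assumes "f differentiable at x" "g differentiable at x"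
  shows "partial i (\<lambda>x. f x + g x) x = partial i f x + partial i g x"
proof -
  have "((\<lambda>x. f x + g x) has_derivative
      (\<lambda>h. frechet_derivative f (at x) h + frechet_derivative g (at x) h)) (at x)"
    using assms by (intro has_derivative_add) (simp_all add: frechet_derivative_works)
  from partial_eqI[OF this] show ?thesis
    by (simp add: partial_def)
qed

lemma partial_mult:
  assumes "f differentiable at x" "g differentiable at x"
  shows "partial i (\<lambda>x. f x * g x) x = partial i f x * g x + f x * partial i g x"
proof -
  have "((\<lambda>x. f x * g x) has_derivative
      (\<lambda>h. f x * frechet_derivative g (at x) h + frechet_derivative f (at x) h * g x)) (at x)"
    using assms by (intro has_derivative_mult) (simp_all add: frechet_derivative_works)
  from partial_eqI[OF this] show ?thesis
    by (simp add: partial_def)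
qed

text \<open>Links \<open>partial\<close> to one-variable calculus: it feeds the mean value theorem
  in \<open>integral_partial_eq_0\<close> and the second derivatives along coordinate lines in the
  Laplace-Beltrami operator.\<close>

lemma has_field_derivative_line:
  fixes f :: "real ^ 'n \<Rightarrow> real"
  assumes "f differentiable at (x + s *\<^sub>R axis i 1)"
  shows "((\<lambda>s. f (x + s *\<^sub>R axis i 1)) has_real_derivative partial i f (x + s *\<^sub>R axis i 1)) (at s)"
proof -
  let ?y = "x + s *\<^sub>R axis i 1"
  have f: "(f has_derivative frechet_derivative f (at ?y)) (at ?y)"
    using assms by (simp add: frechet_derivative_works)
  have "((\<lambda>s. x + s *\<^sub>R axis i 1) has_derivative (\<lambda>h. h *\<^sub>R axis i 1)) (at s)"
    by (auto intro!: derivative_eq_intros)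
  from has_derivative_compose[OF this f]
  have "((\<lambda>s. f (x + s *\<^sub>R axis i 1)) has_derivative (\<lambda>h. frechet_derivative f (at ?y) (h *\<^sub>R axis i 1))) (at s)" .
  also have "(\<lambda>h. frechet_derivative f (at ?y) (h *\<^sub>R axis i 1)) = (\<lambda>h. h * partial i f ?y)"
    using linear_cmul[OF linear_frechet_derivative[OF assms]] by (simp add: partial_def)
  finally show ?thesis
    by (rule has_derivative_imp_has_field_derivative) simp
qed

lemma hpoly_partial_coord:
  assumes "hpoly k f"
  shows "partial i (\<lambda>x. x $ j * f x) = (\<lambda>x. (if i = j then f x else 0) + x $ j * partial i f x)"
proof
  show "partial i (\<lambda>x. x $ j * f x) x = (if i = j then f x else 0) + x $ j * partial i f x" for x
    using assms by (subst partial_mult)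
      (auto simp: partial_nth hpoly_differentiable bounded_linear_imp_differentiable bounded_linear_vec_nth)
qed

lemma hpoly_partial_add:
  assumes "hpoly k f" "hpoly l g"
  shows "partial i (\<lambda>x. f x + g x) = (\<lambda>x. partial i f x + partial i g x)"
  using assms by (auto simp: partial_add hpoly_differentiable)

lemma hpoly_partial_mult:
  assumes "hpoly k f" "hpoly l g"
  shows "partial i (\<lambda>x. f x * g x) = (\<lambda>x. partial i f x * g x + f x * partial i g x)"
  using assms by (auto simp: partial_mult hpoly_differentiable)

text \<open>The degree condition is a separate premise so that rule induction applies; it makes the
  \<open>coord\<close> case vacuous.\<close>

lemma hpoly_partial_0: "hpoly k f \<Longrightarrow> k = 0 \<Longrightarrow> partial i f = (\<lambda>_. 0)"
  by (induction rule: hpoly.induct) (auto simp: partial_const hpoly_partial_add)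

lemma hpoly_partial: "hpoly k f \<Longrightarrow> hpoly (k - 1) (partial i f)"
proof (induction rule: hpoly.induct)
  case (const c)
  have "partial i (\<lambda>_. c) = (\<lambda>_. 0)"
    by (auto simp: partial_const)
  then show ?case
    by (simp add: hpoly_zero)
next
  case (coord k f j)
  \<comment> \<open>The rule \<open>coord\<close> yields degree \<open>Suc (k - 1)\<close>, which is
    \<open>k\<close> only for positive \<open>k\<close>; for \<open>k = 0\<close> the derivative is
    zero.\<close>
  have "hpoly k (\<lambda>x. x $ j * partial i f x)"
  proof (cases k)
    case 0
    then show ?thesis
      using hpoly_partial_0[OF coord.hyps, of i] by (simp add: hpoly_zero)
  next
    case (Suc l)
    then show ?thesis
      using hpoly.coord[OF coord.IH, of j] by simp
  qed
  moreover have "hpoly k (\<lambda>x. if i = j then f x else 0)"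
    using coord.hyps by (cases "i = j") (simp_all add: hpoly_zero)
  ultimately show ?case
    by (simp add: hpoly_partial_coord[OF coord.hyps] hpoly.add)
next
  case (add k f g)
  then show ?case
    by (simp add: hpoly_partial_add hpoly.add)
qed

lemma euler_identity: "hpoly k f \<Longrightarrow> (\<Sum>i\<in>UNIV. x $ i * partial i f x) = real k * f x"
proof (induction rule: hpoly.induct)
  case (coord k f j)
  have "(\<Sum>i\<in>UNIV. x $ i * ((if i = j then f x else 0) + x $ j * partial i f x)) =
      (\<Sum>i\<in>UNIV. if i = j then x $ i * f x else 0) + x $ j * (\<Sum>i\<in>UNIV. x $ i * partial i f x)"
    by (subst sum_distrib_left, subst sum.distrib[symmetric])
       (auto intro!: sum.cong simp: algebra_simps)
  then show ?case
    by (simp add: hpoly_partial_coord[OF coord.hyps] coord.IH distrib_right)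
qed (auto simp: partial_const hpoly_partial_add algebra_simps sum.distrib)

text \<open>Iterating \<open>partial\<close> keeps the result inside \<open>hpoly\<close>; the
  one-variable form \<open>laplacian\<close> is met only when \<open>laplace_beltrami\<close> is
  computed.\<close>

definition lap :: "(real ^ 'n \<Rightarrow> real) \<Rightarrow> real ^ 'n \<Rightarrow> real" where
  "lap f x = (\<Sum>i\<in>UNIV. partial i (partial i f) x)"

lemma hpoly_lap: "hpoly k f \<Longrightarrow> hpoly (k - 2) (lap f)"
  unfolding lap_def[abs_def]
  using hpoly_partial[OF hpoly_partial] by (intro hpoly_sum) (auto simp: numeral_2_eq_2)

lemma lap_eq_0: "hpoly k f \<Longrightarrow> k < 2 \<Longrightarrow> lap f = (\<lambda>_. 0)"
  unfolding lap_def[abs_def] by (simp add: hpoly_partial_0[OF hpoly_partial])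

subsection \<open>Integration over the unit ball\<close>

lemma lborel_integral_scaleR:
  fixes f :: "'a::euclidean_space \<Rightarrow> real"
  assumes [measurable]: "f \<in> borel_measurable borel" and "c > 0"
  shows "(LINT x|lborel. f x) = c ^ DIM('a) * (LINT x|lborel. f (c *\<^sub>R x))"
proof -
  have "lborel = density (distr lborel borel (\<lambda>x::'a. 0 + c *\<^sub>R x)) (\<lambda>_. \<bar>c\<bar> ^ DIM('a))"
    using assms by (intro lborel_affine) auto
  also have "\<dots> = density (distr lborel borel (\<lambda>x::'a. c *\<^sub>R x)) (\<lambda>_. ennreal (c ^ DIM('a)))"
    using assms by simp
  finally have "(LINT x|lborel. f x) =
      (LINT x|density (distr lborel borel (\<lambda>x::'a. c *\<^sub>R x)) (\<lambda>_. ennreal (c ^ DIM('a))). f x)"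
    by simp
  also have "\<dots> = (LINT x|distr lborel borel (\<lambda>x::'a. c *\<^sub>R x). c ^ DIM('a) * f x)"
    using assms by (subst integral_density) auto
  also have "\<dots> = (LINT x|lborel. c ^ DIM('a) * f (c *\<^sub>R x))"
    by (subst integral_distr) auto
  finally show ?thesis
    by simp
qed

lemma lborel_integral_translation:
  fixes f :: "'a::euclidean_space \<Rightarrow> real"
  assumes "f \<in> borel_measurable borel"
  shows "(LINT x|lborel. f (x + c)) = (LINT x|lborel. f x)"
proof -
  have "(LINT x|lborel. f x) = (LINT x|distr lborel borel ((+) c). f x)"
    by (simp add: lborel_distr_plus)
  also have "\<dots> = (LINT x|lborel. f (c + x))"
    using assms by (subst integral_distr) auto
  finally show ?thesis
    by (simp add: add.commute)
qed

lemma continuous_bound_cball: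
  fixes f :: "'a::euclidean_space \<Rightarrow> real"
  assumes "continuous_on UNIV f"
  obtains C where "\<And>x. norm x \<le> r \<Longrightarrow> \<bar>f x\<bar> \<le> C"
proof -
  have "bounded (f ` cball 0 r)"
    using assms by (intro compact_imp_bounded compact_continuous_image) (auto intro: continuous_on_subset)
  then obtain C where "\<forall>y \<in> f ` cball 0 r. norm y \<le> C"
    unfolding bounded_iff by blast
  then show ?thesis
    by (intro that[of C]) simp
qed

text \<open>Each difference quotient has integral zero by translation invariance, and dominated
  convergence passes this to the derivative.\<close>

lemma integral_partial_eq_0:
  fixes F :: "real ^ 'n \<Rightarrow> real"
  assumes diff: "\<And>x. F differentiable at x"
    and cont: "continuous_on UNIV (partial i F)"
    and supp: "\<And>x. norm x > 1 \<Longrightarrow> F x = 0"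
  shows "(LINT x|lborel. partial i F x) = 0"
proof -
  define e :: "real ^ 'n" where "e = axis i 1"
  define h :: "nat \<Rightarrow> real" where "h = (\<lambda>n. inverse (real (Suc n)))"
  define s where "s = (\<lambda>n x. (F (x + h n *\<^sub>R e) - F x) / h n)"
  have e: "norm e = 1"
    by (simp add: e_def)
  have h: "0 < h n" "h n \<le> 1" for n
    by (auto simp: h_def field_simps)
  have contF: "continuous_on UNIV F"
    using diff differentiable_imp_continuous_on[of F UNIV]
    by (simp add: differentiable_on_def)
  have [measurable]: "F \<in> borel_measurable borel"
    using contF by (rule borel_measurable_continuous_onI)
  have D: "((\<lambda>t. F (x + t *\<^sub>R e)) has_real_derivative partial i F (x + t *\<^sub>R e)) (at t)" for x t
    unfolding e_def by (intro has_field_derivative_line diff)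
  obtain C where C: "\<And>x. norm x \<le> 3 \<Longrightarrow> \<bar>partial i F x\<bar> \<le> C"
    using continuous_bound_cball[OF cont, of 3] by blast
  \<comment> \<open>Steps have length at most 1. For \<open>norm x\<close> at most 2 the mean value
    theorem evaluates the derivative inside radius 3; beyond that both points lie outside the
    support.\<close>
  have bound: "norm (s n x) \<le> C * indicator (cball 0 2) x" for n x
  proof (cases "norm x \<le> 2")
    case True
    have "\<exists>z>0. z < h n \<and> F (x + h n *\<^sub>R e) - F (x + 0 *\<^sub>R e) = (h n - 0) * partial i F (x + z *\<^sub>R e)"
      using h(1) D by (rule MVT2)
    then obtain z where z: "0 < z" "z < h n"
      "F (x + h n *\<^sub>R e) - F (x + 0 *\<^sub>R e) = (h n - 0) * partial i F (x + z *\<^sub>R e)"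
      by blast
    have "norm (x + z *\<^sub>R e) \<le> norm x + norm (z *\<^sub>R e)"
      by (rule norm_triangle_ineq)
    also have "\<dots> \<le> 3"
      using True z h(2)[of n] by (simp add: e)
    finally have "\<bar>partial i F (x + z *\<^sub>R e)\<bar> \<le> C"
      by (rule C)
    moreover have "s n x = partial i F (x + z *\<^sub>R e)"
      using z(3) h(1)[of n] by (simp add: s_def)
    ultimately show ?thesis
      using True by simp
  next
    case False
    have "norm x \<le> norm (x + h n *\<^sub>R e) + norm (h n *\<^sub>R e)"
      using norm_triangle_ineq4[of "x + h n *\<^sub>R e" "h n *\<^sub>R e"] by simp
    then have "norm (x + h n *\<^sub>R e) > 1"
      using False h[of n] by (simp add: e)
    then show ?thesis
      using False by (simp add: s_def supp)
  qed
  have lim: "(\<lambda>n. s n x) \<longlonglongrightarrow> partial i F x" for x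
  proof -
    have "((\<lambda>t. (F (x + t *\<^sub>R e) - F x) / t) \<longlongrightarrow> partial i F x) (at 0)"
      using D[of x 0] by (simp add: has_field_derivative_iff)
    moreover have "filterlim h (at 0) sequentially"
      unfolding h_def using LIMSEQ_inverse_real_of_nat by (auto simp: filterlim_at)
    ultimately show ?thesis
      unfolding s_def by (rule filterlim_compose)
  qed
  have dom: "integrable lborel (\<lambda>x::real^'n. C * indicator (cball 0 2) x)"
    by (intro integrable_mult_right integrable_real_indicator)
       (use emeasure_lborel_cball_finite[of "0 :: real ^ 'n" 2] in auto)
  have int: "(\<lambda>n. LINT x|lborel. s n x) \<longlonglongrightarrow> (LINT x|lborel. partial i F x)"
    using dom
  proof (rule integral_dominated_convergence[rotated 2])
    show "AE x in lborel. (\<lambda>n. s n x) \<longlonglongrightarrow> partial i F x"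
      by (simp add: lim)
    show "AE x in lborel. norm (s n x) \<le> C * indicator (cball 0 2) x" for n
      using bound by simp
    show "partial i F \<in> borel_measurable lborel"
      using borel_measurable_continuous_onI[OF cont] by simp
    show "s n \<in> borel_measurable lborel" for n
      unfolding s_def by measurable
  qed
  have intF: "integrable lborel F"
  proof -
    have "integrable lborel (\<lambda>x. indicator (cball 0 1) x *\<^sub>R F x)"
      by (rule borel_integrable_compact[OF compact_cball continuous_on_subset[OF contF]]) simp
    also have "(\<lambda>x. indicator (cball 0 1) x *\<^sub>R F x) = F"
      by (auto simp: fun_eq_iff indicator_def supp)
    finally show ?thesis .
  qed
  have intF': "integrable lborel (\<lambda>x. F (x + c))" for c
  proof -
    have "integrable (distr lborel borel ((+) c)) F"
      by (simp add: lborel_distr_plus intF)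
    then have "integrable lborel (\<lambda>x. F (c + x))"
      by (subst (asm) integrable_distr_eq) auto
    then show ?thesis
      by (simp add: add.commute)
  qed
  have "(LINT x|lborel. s n x) = 0" for n
    unfolding s_def by (simp add: intF intF' lborel_integral_translation)
  with int show ?thesis
    by (simp add: LIMSEQ_const_iff)
qed

text \<open>Layer-cake: write \<open>1 - norm x ^ m\<close> as the integral of \<open>m r ^ (m - 1)\<close> over
  \<open>norm x \<le> r \<le> 1\<close>, exchange the integrals and scale.\<close>

lemma integral_norm_power_cball:
  fixes G :: "'a::euclidean_space \<Rightarrow> real"
  assumes [measurable]: "G \<in> borel_measurable borel"
    and bound: "\<And>x. \<bar>G x\<bar> \<le> C"
    and hom: "\<And>r x. r > 0 \<Longrightarrow> G (r *\<^sub>R x) = G x"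
  shows "(LINT x:cball 0 1 - {0}|lborel. norm x ^ m * G x) =
    real DIM('a) / real (DIM('a) + m) * (LINT x:cball 0 1 - {0}|lborel. G x)"
proof (cases m)
  case 0
  then show ?thesis by simp
next
  case (Suc k)
  let ?d = "DIM('a)"
  define B :: "'a set" where "B = cball 0 1 - {0}"
  define J where "J = (LINT x|lborel. indicator B x * G x)"
  have [measurable]: "B \<in> sets borel"
    by (simp add: B_def)
  have B_finite: "emeasure lborel B < \<infinity>"
    using emeasure_mono[of B "cball 0 1" lborel] emeasure_lborel_cball_finite[of "0::'a" 1]
    by (auto simp: B_def intro: le_less_trans)
  define F :: "'a \<Rightarrow> real \<Rightarrow> real" where
    "F = (\<lambda>x r. indicator B x * G x * (real m * r ^ k) * indicator {norm x..1} r)"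
  have intF: "integrable (lborel \<Otimes>\<^sub>M lborel) (case_prod F)"
  proof (rule Bochner_Integration.integrable_bound)
    have "emeasure (lborel \<Otimes>\<^sub>M lborel) (B \<times> {0..1::real}) < \<infinity>"
      using B_finite by (simp add: lborel.emeasure_pair_measure_Times)
    then show "integrable (lborel \<Otimes>\<^sub>M lborel)
        (\<lambda>z. \<bar>C\<bar> * real m * indicator (B \<times> {0..1::real}) z)"
      by (intro integrable_mult_right integrable_real_indicator) auto
    have [measurable]: "(\<lambda>z::'a \<times> real. indicator {norm (fst z)..1} (snd z) :: real)
        \<in> borel_measurable (lborel \<Otimes>\<^sub>M lborel)"
      unfolding indicator_def atLeastAtMost_iff by measurable
    show "case_prod F \<in> borel_measurable (lborel \<Otimes>\<^sub>M lborel)"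
      unfolding F_def split_beta' by measurable
    show "AE z in lborel \<Otimes>\<^sub>M lborel. norm (case_prod F z) \<le>
        norm (\<bar>C\<bar> * real m * indicator (B \<times> {0..1::real}) z)"
    proof (intro AE_I2)
      fix z :: "'a \<times> real"
      obtain x r where z: "z = (x, r)" by force
      show "norm (case_prod F z) \<le> norm (\<bar>C\<bar> * real m * indicator (B \<times> {0..1::real}) z)"
      proof (cases "x \<in> B \<and> norm x \<le> r \<and> r \<le> 1")
        case True
        then have "0 \<le> r" using norm_ge_zero order_trans by blast
        moreover have "r ^ k \<le> 1"
          using True \<open>0 \<le> r\<close> by (intro power_le_one) auto
        moreover have "\<bar>G x\<bar> \<le> \<bar>C\<bar>"
          using bound[of x] by simp
        ultimately have "\<bar>G x\<bar> * (real m * r ^ k) \<le> \<bar>C\<bar> * (real m * 1)"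
          by (intro mult_mono) auto
        then show ?thesis
          using True \<open>0 \<le> r\<close> by (simp add: z F_def abs_mult)
      qed (auto simp: z F_def)
    qed
  qed
  have inner1: "(LINT r|lborel. F x r) = indicator B x * (G x - norm x ^ m * G x)" for x
  proof (cases "x \<in> B")
    case True
    then have "norm x \<le> 1"
      by (simp add: B_def)
    then have int: "(LINT r|lborel. r ^ k * indicator {norm x..1} r) = (1 - norm x ^ m) / real m"
      using integral_power[of "norm x" 1 k] Suc by simp
    have "real m \<noteq> 0"
      using Suc by simp
    then have "(LINT r|lborel. (G x * real m) * (r ^ k * indicator {norm x..1} r)) =
        G x - norm x ^ m * G x"
      by (simp only: integral_mult_right_zero int) (simp add: field_simps)
    with True show ?thesis
      by (simp add: F_def mult_ac)
  qed (simp add: F_def)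
  have inner2: "(LINT x|lborel. F x r) = real m * J * (r ^ (k + ?d) * indicator {0..1} r)" for r
  proof (cases "0 < r \<and> r \<le> 1")
    case True
    have "F x r = real m * r ^ k * (indicator B ((1 / r) *\<^sub>R x) * G x)" for x
      using True by (auto simp: F_def B_def indicator_def field_simps)
    then have "(LINT x|lborel. F x r) = real m * r ^ k * (LINT x|lborel. indicator B ((1 / r) *\<^sub>R x) * G x)"
      by simp
    also have "(LINT x|lborel. indicator B ((1 / r) *\<^sub>R x) * G x) =
        r ^ ?d * (LINT x|lborel. indicator B ((1 / r) *\<^sub>R (r *\<^sub>R x)) * G (r *\<^sub>R x))"
      using True by (subst lborel_integral_scaleR[of _ r]) auto
    also have "(LINT x|lborel. indicator B ((1 / r) *\<^sub>R (r *\<^sub>R x)) * G (r *\<^sub>R x)) = J"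
      using True by (simp add: J_def hom)
    finally show ?thesis
      using True by (simp add: power_add)
  next
    case False
    \<comment> \<open>This leaves \<open>r\<close> nonpositive or above 1. At \<open>r = 0\<close>
      the left side vanishes because \<open>B\<close> omits the origin, the right side because the
      exponent \<open>k + d\<close> is positive.\<close>
    have "F x r = 0" for x
    proof (cases "x \<noteq> 0 \<and> norm x \<le> r \<and> r \<le> 1")
      case True
      then have "0 < r"
        using zero_less_norm_iff[of x] by linarith
      with True False show ?thesis
        by simp
    qed (auto simp: F_def B_def indicator_def)
    moreover have "r ^ (k + ?d) * indicator {0..1} r = 0"
      using False by (cases "r = 0") (auto simp: indicator_def)
    ultimately show ?thesis
      by simp
  qed
  have intG: "integrable lborel (\<lambda>x. indicator B x * (norm x ^ l * G x))" for l
  proof (rule Bochner_Integration.integrable_bound)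
    show "integrable lborel (\<lambda>x. \<bar>C\<bar> * indicator B x)"
      using B_finite by (intro integrable_mult_right integrable_real_indicator) auto
    show "AE x in lborel. norm (indicator B x * (norm x ^ l * G x)) \<le> norm (\<bar>C\<bar> * indicator B x)"
    proof (intro AE_I2)
      fix x
      show "norm (indicator B x * (norm x ^ l * G x)) \<le> norm (\<bar>C\<bar> * indicator B x)"
      proof (cases "x \<in> B")
        case True
        then have "norm x ^ l \<le> 1"
          by (intro power_le_one) (auto simp: B_def)
        then have "norm x ^ l * \<bar>G x\<bar> \<le> 1 * \<bar>C\<bar>"
          using bound[of x] by (intro mult_mono) auto
        with True show ?thesis
          by (simp add: abs_mult)
      qed simp
    qed
  qed measurable
  have "(LINT r|lborel. LINT x|lborel. F x r) = (LINT x|lborel. LINT r|lborel. F x r)"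
    by (rule lborel_pair.Fubini_integral[OF intF])
  also have "(LINT x|lborel. LINT r|lborel. F x r) = J - (LINT x|lborel. indicator B x * (norm x ^ m * G x))"
    using intG[of 0] intG[of m] by (simp add: inner1 J_def right_diff_distrib)
  also have "(LINT r|lborel. LINT x|lborel. F x r) =
      real m * J * (LINT r|lborel. r ^ (k + ?d) * indicator {0..1} r)"
    by (simp add: inner2)
  also have "\<dots> = real m * J / real (?d + m)"
    using integral_power[of 0 1 "k + ?d"] Suc by (simp add: add.commute)
  finally have "(LINT x|lborel. indicator B x * (norm x ^ m * G x)) = J - real m * J / real (?d + m)"
    by simp
  also have "\<dots> = real ?d / real (?d + m) * J"
    using Suc by (simp add: field_simps)
  finally show ?thesis
    by (simp add: set_lebesgue_integral_def J_def B_def)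
qed

subsection \<open>Integration over the sphere\<close>

definition sph :: "(real ^ 'n \<Rightarrow> real) \<Rightarrow> real" where
  "sph f = (LINT \<xi>|surface_measure. f \<xi>)"

lemma measurable_surface_measure:
  "f \<in> borel_measurable borel \<Longrightarrow> f \<in> borel_measurable (surface_measure :: (real ^ 'n) measure)"
  using measurable_restrict_space1[of f borel borel "sphere 0 1"]
  by (subst measurable_cong_sets[OF sets_surface_measure refl])

lemma finite_surface_measure: "finite_measure (surface_measure :: (real ^ 'n) measure)"
  by (rule finite_measureI) (simp add: surface_measure_sphere)

lemma integrable_surface_measure:
  fixes f :: "real ^ 'n \<Rightarrow> real"
  assumes "continuous_on UNIV f"
  shows "integrable surface_measure f"
proof -
  obtain C where "\<And>x. norm x \<le> 1 \<Longrightarrow> \<bar>f x\<bar> \<le> C"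
    using continuous_bound_cball[OF assms, of 1] by blast
  then have "AE x in surface_measure. norm (f x) \<le> C"
    by (intro AE_I2) simp
  then show ?thesis
    using assms
    by (intro finite_measure.integrable_const_bound[OF finite_surface_measure]
        measurable_surface_measure borel_measurable_continuous_onI)
qed

lemma sph_cong: "(\<And>x. norm x = 1 \<Longrightarrow> f x = g x) \<Longrightarrow> sph f = sph g"
  unfolding sph_def by (intro Bochner_Integration.integral_cong) auto

lemma sph_scale: "sph (\<lambda>x. c * f x) = c * sph f"
  by (simp add: sph_def)

lemma sph_add:
  "continuous_on UNIV f \<Longrightarrow> continuous_on UNIV g \<Longrightarrow> sph (\<lambda>x. f x + g x) = sph f + sph g"
  by (simp add: sph_def integrable_surface_measure)

lemma sph_sum:
  "(\<And>i. i \<in> A \<Longrightarrow> continuous_on UNIV (f i)) \<Longrightarrow> sph (\<lambda>x. \<Sum>i\<in>A. f i x) = (\<Sum>i\<in>A. sph (f i))"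
  by (simp add: sph_def integrable_surface_measure)

text \<open>Unfolds the surface measure: scaling is a constant density, the push-forward along
  \<open>sgn\<close> substitutes \<open>sgn x\<close>, and the restriction becomes a set integral.
  The integrand is the extension of \<open>f\<close> constant along rays.\<close>

lemma sph_eq_ball_integral:
  fixes f :: "real ^ 'n \<Rightarrow> real"
  assumes [measurable]: "f \<in> borel_measurable borel"
  shows "sph f = real CARD('n) * (LINT x:ball 0 1 - {0}|lborel. f (sgn x))"
proof -
  let ?d = "CARD('n)"
  let ?M = "distr (restrict_space lborel (ball 0 1 - {0})) (restrict_space borel (sphere 0 1)) sgn
    :: (real ^ 'n) measure"
  have f: "f \<in> borel_measurable ?M"
    using measurable_restrict_space1[OF assms, of "sphere 0 1"] by simp
  have "(surface_measure :: (real ^ 'n) measure) = density ?M (\<lambda>_. ennreal (real ?d))"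
  proof (rule measure_eqI)
    fix A :: "(real ^ 'n) set"
    assume "A \<in> sets surface_measure"
    then have "A \<in> sets ?M"
      by (simp add: surface_measure_def)
    then show "emeasure surface_measure A = emeasure (density ?M (\<lambda>_. ennreal (real ?d))) A"
      unfolding surface_measure_def emeasure_scale_measure
      by (subst emeasure_density) (auto simp: nn_integral_cmult ennreal_of_nat_eq_real_of_nat)
  qed (simp add: surface_measure_def)
  then have "sph f = (LINT x|density ?M (\<lambda>_. ennreal (real ?d)). f x)"
    by (simp add: sph_def)
  also have "\<dots> = real ?d * (LINT x|?M. f x)"
    using f by (subst integral_density) auto
  also have "(LINT x|?M. f x) = (LINT x|restrict_space lborel (ball 0 1 - {0}). f (sgn x))"
    using f by (subst integral_distr[OF sgn_measurable_sphere]) auto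
  also have "\<dots> = (LINT x:ball 0 1 - {0}|lborel. f (sgn x))"
    by (subst integral_restrict_space) (auto simp: set_lebesgue_integral_def)
  finally show ?thesis .
qed

lemma sgn_measurable_vec [measurable]: "(sgn :: real ^ 'n \<Rightarrow> _) \<in> borel_measurable borel"
proof -
  have "(\<lambda>x :: real ^ 'n. inverse (norm x) *\<^sub>R x) \<in> borel_measurable borel"
    by measurable
  then show ?thesis
    by (simp add: sgn_div_norm[abs_def])
qed

text \<open>The sphere is a null set. The closed ball suits the layer-cake formula and gives
  integrability by compactness; the open ball is kept for positivity arguments.\<close>

lemma sph_eq_cball_integral:
  fixes f :: "real ^ 'n \<Rightarrow> real"
  assumes [measurable]: "f \<in> borel_measurable borel"
  shows "sph f = real CARD('n) * (LINT x:cball 0 1 - {0}|lborel. f (sgn x))"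
proof -
  have fs: "(\<lambda>x. f (sgn x)) \<in> borel_measurable borel"
    by measurable
  have "sphere 0 1 \<in> null_sets (lborel :: (real ^ 'n) measure)"
    using negligible_sphere[of "0 :: real ^ 'n" 1]
    by (simp add: negligible_iff_null_sets null_sets_completion_iff)
  then have "AE x :: real ^ 'n in lborel. x \<notin> sphere 0 1"
    by (rule AE_not_in)
  then have "AE x in lborel. indicator (ball 0 1 - {0}) x *\<^sub>R f (sgn x) =
      indicator (cball 0 1 - {0}) x *\<^sub>R f (sgn x)"
    by (rule AE_mp) (auto intro!: AE_I2 simp: indicator_def)
  then have "(LINT x:ball 0 1 - {0}|lborel. f (sgn x)) = (LINT x:cball 0 1 - {0}|lborel. f (sgn x))"
    unfolding set_lebesgue_integral_def
    by (intro integral_cong_AE) (auto intro!: borel_measurable_times borel_measurable_indicator fs)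
  then show ?thesis
    by (simp add: sph_eq_ball_integral)
qed

text \<open>Write \<open>f x\<close> as \<open>norm x ^ k * f (sgn x)\<close>: the layer-cake factor
  \<open>d / (d + k)\<close> meets the factor \<open>d\<close> in the surface measure. Volume
  identities thereby become sphere identities.\<close>

lemma hpoly_ball_integral:
  fixes f :: "real ^ 'n \<Rightarrow> real"
  assumes f: "hpoly k f"
  shows "(LINT x:cball 0 1 - {0}|lborel. f x) = sph f / real (CARD('n) + k)"
proof -
  note [measurable] = hpoly_measurable[OF f]
  obtain C where C: "\<And>x. norm x \<le> 1 \<Longrightarrow> \<bar>f x\<bar> \<le> C"
    using continuous_bound_cball[OF hpoly_continuous_on[OF f], of 1] by blast
  have "f x = norm x ^ k * f (sgn x)" if "x \<noteq> 0" for x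
  proof -
    have "f (norm x *\<^sub>R sgn x) = norm x ^ k * f (sgn x)"
      by (rule hpoly_scaleR[OF f])
    then show ?thesis
      using that by (simp add: sgn_div_norm)
  qed
  then have "(LINT x:cball 0 1 - {0}|lborel. f x) = (LINT x:cball 0 1 - {0}|lborel. norm x ^ k * f (sgn x))"
    by (intro set_lebesgue_integral_cong) auto
  also have "\<dots> = real DIM(real ^ 'n) / real (DIM(real ^ 'n) + k) *
      (LINT x:cball 0 1 - {0}|lborel. f (sgn x))"
    by (rule integral_norm_power_cball[where C = C]) (auto simp: sgn_scaleR norm_sgn intro: C)
  finally show ?thesis
    by (simp add: sph_eq_cball_integral)
qed

lemma hpoly_set_integrable:
  fixes f :: "real ^ 'n \<Rightarrow> real"
  assumes "hpoly k f"
  shows "set_integrable lborel (cball 0 1 - {0}) f"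
proof -
  have "set_integrable lborel (cball 0 1) f"
    unfolding set_integrable_def
    by (rule borel_integrable_compact[OF compact_cball hpoly_continuous_on[OF assms]])
  then show ?thesis
    by (rule set_integrable_subset) auto
qed

section \<open>Integration by parts and Green's identity on the sphere\<close>

lemma DERIV_max_square: "((\<lambda>s. (max 0 s)\<^sup>2) has_real_derivative 2 * max 0 s) (at (s::real))"
proof -
  consider "s > 0" | "s < 0" | "s = 0" by linarith
  then show ?thesis
  proof cases
    case 1
    have "((\<lambda>s. s\<^sup>2) has_real_derivative 2 * max 0 s) (at s)"
      using 1 by (auto intro!: derivative_eq_intros)
    then show ?thesis
      by (rule has_field_derivative_transform_within_open[where S = "{0<..}"]) (use 1 in auto)
  next
    case 2
    have "((\<lambda>s. 0) has_real_derivative 2 * max 0 s) (at s)"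
      using 2 by (auto intro!: derivative_eq_intros)
    then show ?thesis
      by (rule has_field_derivative_transform_within_open[where S = "{..<0}"]) (use 2 in auto)
  next
    case 3
    have "((\<lambda>y::real. (max 0 y)\<^sup>2 / y) \<longlongrightarrow> 0) (at 0)"
    proof (rule Lim_null_comparison)
      show "\<forall>\<^sub>F y in at 0. norm ((max 0 y)\<^sup>2 / y) \<le> norm (y::real)"
        by (intro always_eventually) (auto simp: max_def power2_eq_square)
      show "((\<lambda>y::real. norm y) \<longlongrightarrow> 0) (at 0)"
        by (intro tendsto_norm_zero tendsto_ident_at)
    qed
    then show ?thesis
      using 3 by (simp add: has_field_derivative_iff)
  qed
qed

text \<open>The divergence theorem for \<open>(1 - |x|\<^sup>2)\<^sup>2 f(x)\<close>; the square makes the extension by zero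
  continuously differentiable.\<close>

lemma hpoly_sphere_parts:
  fixes f :: "real ^ 'n \<Rightarrow> real"
  assumes f: "hpoly k f"
  shows "sph (partial i f) = (real k + real CARD('n) - 1) * sph (\<lambda>x. x $ i * f x)"
proof -
  let ?d = "CARD('n)" and ?B = "cball 0 1 - {0} :: (real ^ 'n) set"
  define f' where "f' = partial i f"
  define g where "g = (\<lambda>x. x $ i * f x)"
  define N where "N = (\<lambda>x :: real ^ 'n. (norm x)\<^sup>2)"
  \<comment> \<open>Multiplying by \<open>N\<close> leaves the sphere integral alone but raises the
    degree by 2, hence the denominator of the ball integral. All terms below thus involve just two
    sphere integrals.\<close>
  have sph_N: "sph (\<lambda>x. N x * u x) = sph u" for u
    by (rule sph_cong) (simp add: N_def)
  define W where "W = (\<lambda>x. (max 0 (1 - N x))\<^sup>2)"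
  have N: "hpoly 2 N"
    unfolding N_def by (rule hpoly_norm_square)
  have g: "hpoly (k + 1) g"
    using hpoly.coord[OF f] by (simp add: g_def)
  have f': "hpoly (k - 1) f'"
    unfolding f'_def by (rule hpoly_partial[OF f])
  have W_deriv: "(W has_derivative (\<lambda>h. frechet_derivative N (at x) h * (- 2 * max 0 (1 - N x)))) (at x)" for x
  proof -
    have "(N has_derivative frechet_derivative N (at x)) (at x)"
      using hpoly_differentiable[OF N] by (simp add: frechet_derivative_works)
    then have "((\<lambda>x. 1 - N x) has_derivative (\<lambda>h. 0 - frechet_derivative N (at x) h)) (at x)"
      by (intro has_derivative_diff has_derivative_const)
    from has_derivative_compose[OF this DERIV_max_square[unfolded has_field_derivative_def]]
    show ?thesis
      unfolding W_def by (rule has_derivative_eq_rhs) (auto simp: fun_eq_iff)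
  qed
  have W_diff: "W differentiable at x" for x
    using W_deriv differentiableI by blast
  have N_partial: "partial i N x = 2 * x $ i" for x
  proof -
    have "N = (\<lambda>x. x \<bullet> x)"
      by (simp add: N_def power2_norm_eq_inner)
    moreover have "((\<lambda>x. x \<bullet> x) has_derivative (\<lambda>h. x \<bullet> h + h \<bullet> x)) (at x)"
      by (intro has_derivative_inner has_derivative_ident)
    ultimately have "(N has_derivative (\<lambda>h. x \<bullet> h + h \<bullet> x)) (at x)"
      by simp
    from partial_eqI[OF this] show ?thesis
      by (simp add: inner_axis inner_axis')
  qed
  have W_partial: "partial i W x = - 4 * x $ i * max 0 (1 - N x)" for x
    using partial_eqI[OF W_deriv] N_partial by (simp add: partial_def)
  have F_partial: "partial i (\<lambda>x. W x * f x) = (\<lambda>x. W x * f' x - 4 * (max 0 (1 - N x) * g x))"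
    using partial_mult[OF W_diff hpoly_differentiable[OF f]] by (simp add: fun_eq_iff W_partial f'_def g_def)
  have "(LINT x|lborel. partial i (\<lambda>x. W x * f x) x) = 0"
  proof (rule integral_partial_eq_0)
    show "(\<lambda>x. W x * f x) differentiable at x" for x
      by (intro differentiable_mult W_diff hpoly_differentiable[OF f])
    show "continuous_on UNIV (partial i (\<lambda>x. W x * f x))"
      unfolding F_partial unfolding W_def
      by (intro continuous_intros hpoly_continuous_on[OF f'] hpoly_continuous_on[OF N] hpoly_continuous_on[OF g])
    show "W x * f x = 0" if "norm x > 1" for x
    proof -
      have "N x > 1"
        using that by (simp add: N_def one_less_power)
      then show ?thesis
        by (simp add: W_def)
    qed
  qed
  \<comment> \<open>On the ball the cutoff is the polynomial \<open>1 - 2 N + N^2\<close>, so the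
    integrand splits into homogeneous terms; outside it vanishes, and the origin is
    negligible.\<close>
  also have "(LINT x|lborel. partial i (\<lambda>x. W x * f x) x) =
      (LINT x:?B|lborel. (f' x - 2 * (N x * f' x) + N x * (N x * f' x)) - 4 * (g x - N x * g x))"
    unfolding F_partial set_lebesgue_integral_def
  proof (rule integral_cong_AE)
    have "W x * f' x - 4 * (max 0 (1 - N x) * g x) = indicator ?B x *\<^sub>R
        ((f' x - 2 * (N x * f' x) + N x * (N x * f' x)) - 4 * (g x - N x * g x))" if "x \<noteq> 0" for x
    proof (cases "norm x \<le> 1")
      case True
      then have "N x \<le> 1"
        by (simp add: N_def power_le_one)
      with True that show ?thesis
        by (simp add: W_def power2_eq_square algebra_simps)
    next
      case False
      then have "N x > 1"
        by (simp add: N_def one_less_power)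
      with False show ?thesis
        by (simp add: W_def)
    qed
    then show "AE x in lborel. W x * f' x - 4 * (max 0 (1 - N x) * g x) = indicator ?B x *\<^sub>R
        ((f' x - 2 * (N x * f' x) + N x * (N x * f' x)) - 4 * (g x - N x * g x))"
      using AE_lborel_singleton[of "0 :: real ^ 'n"] by auto
  qed (use hpoly_measurable[OF f'] hpoly_measurable[OF g] hpoly_measurable[OF N] in
      \<open>auto simp: W_def intro!: borel_measurable_indicator borel_measurable_times borel_measurable_diff
        borel_measurable_add borel_measurable_max borel_measurable_power\<close>)
  also have "\<dots> = (LINT x:?B|lborel. f' x) - 2 * (LINT x:?B|lborel. N x * f' x)
      + (LINT x:?B|lborel. N x * (N x * f' x))
      - 4 * ((LINT x:?B|lborel. g x) - (LINT x:?B|lborel. N x * g x))"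
    by (simp add: hpoly_set_integrable[OF f'] hpoly_set_integrable[OF g]
        hpoly_set_integrable[OF hpoly_mult[OF N f']] hpoly_set_integrable[OF hpoly_mult[OF N g]]
        hpoly_set_integrable[OF hpoly_mult[OF N hpoly_mult[OF N f']]])
  also have "(LINT x:?B|lborel. g x) = sph g / (real ?d + real k + 1)"
    using hpoly_ball_integral[OF g] by (simp add: add_ac)
  also have "(LINT x:?B|lborel. N x * g x) = sph g / (real ?d + real k + 3)"
    using hpoly_ball_integral[OF hpoly_mult[OF N g]] by (simp add: sph_N add_ac)
  finally have eq: "(LINT x:?B|lborel. f' x) - 2 * (LINT x:?B|lborel. N x * f' x)
      + (LINT x:?B|lborel. N x * (N x * f' x))
      = 4 * (sph g / (real ?d + real k + 1) - sph g / (real ?d + real k + 3))"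
    by simp
  have "sph f' = (real k + real ?d - 1) * sph g"
  proof (cases k)
    case 0
    then have f'_0: "f' = (\<lambda>_. 0)"
      using hpoly_partial_0[OF f] by (simp add: f'_def)
    \<comment> \<open>This is \<open>(d + 1) (d + 3)\<close> multiplied out. For constant
      \<open>f\<close> the derivative is zero, and the two unequal denominators force
      \<open>sph g = 0\<close>.\<close>
    have "3 + (real ?d * real ?d + real ?d * 4) > 0"
      by (intro add_pos_nonneg) auto
    with eq 0 f'_0 have "sph g = 0"
      by (simp add: field_simps set_lebesgue_integral_def)
    then show ?thesis
      by (simp add: f'_0 sph_def)
  next
    case (Suc l)
    define D where "D = real ?d + real l"
    have D: "D > 0"
      by (simp add: D_def add_pos_nonneg)
    have "(LINT x:?B|lborel. f' x) = sph f' / D"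
      using hpoly_ball_integral[OF f'] Suc by (simp add: D_def)
    moreover have "(LINT x:?B|lborel. N x * f' x) = sph f' / (D + 2)"
      using hpoly_ball_integral[OF hpoly_mult[OF N f']] Suc by (simp add: sph_N D_def add_ac)
    moreover have "(LINT x:?B|lborel. N x * (N x * f' x)) = sph f' / (D + 4)"
      using hpoly_ball_integral[OF hpoly_mult[OF N hpoly_mult[OF N f']]] Suc
      by (simp add: sph_N D_def add_ac)
    ultimately have "sph f' / D - 2 * (sph f' / (D + 2)) + sph f' / (D + 4) =
        4 * (sph g / (D + 2) - sph g / (D + 4))"
      using eq Suc by (simp add: D_def add_ac)
    \<comment> \<open>Both sides carry the same constant: \<open>1/D - 2/(D + 2) + 1/(D + 4)\<close>
      is \<open>8 / (D (D + 2) (D + 4))\<close>, and \<open>4 (1/(D + 2) - 1/(D + 4))\<close> is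
      \<open>8 / ((D + 2) (D + 4))\<close>.\<close>
    then have "8 * (sph f' - D * sph g) = 0"
      using D by (simp add: divide_simps) (simp add: algebra_simps)
    then show ?thesis
      using Suc by (simp add: D_def add_ac)
  qed
  then show ?thesis
    by (simp add: f'_def g_def)
qed

text \<open>Apply \<open>hpoly_sphere_parts\<close> to \<open>partial i u * q\<close>, of degree
  \<open>j - 1 + k\<close>, and sum over \<open>i\<close>; Euler's identity turns the right side
  into \<open>j * u * q\<close>. Degree \<open>j = 0\<close> is split off because
  \<open>j - 1\<close> is truncated.\<close>

lemma sph_lap_mult:
  fixes u q :: "real ^ 'n \<Rightarrow> real"
  assumes u: "hpoly j u" and q: "hpoly k q"
  shows "sph (\<lambda>x. lap u x * q x) + sph (\<lambda>x. \<Sum>i\<in>UNIV. partial i u x * partial i q x) =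
    real j * (real j + real k + real CARD('n) - 2) * sph (\<lambda>x. u x * q x)"
proof (cases j)
  case 0
  then have "partial i u = (\<lambda>_. 0)" "lap u = (\<lambda>_. 0)" for i
    using hpoly_partial_0[OF u] lap_eq_0[OF u] by auto
  with 0 show ?thesis
    by (simp add: sph_def)
next
  case (Suc l)
  let ?c = "real j + real k + real CARD('n) - 2"
  have u': "hpoly l (partial i u)" for i
    using hpoly_partial[OF u] Suc by simp
  note cont = hpoly_continuous_on[OF hpoly_mult[OF hpoly_partial[OF u'] q]]
    hpoly_continuous_on[OF hpoly_mult[OF u' hpoly_partial[OF q]]]
  have parts: "sph (\<lambda>x. partial i (partial i u) x * q x) + sph (\<lambda>x. partial i u x * partial i q x) =
      ?c * sph (\<lambda>x. x $ i * (partial i u x * q x))" for i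
  proof -
    have "sph (\<lambda>x. partial i (partial i u) x * q x + partial i u x * partial i q x) =
        (real (l + k) + real CARD('n) - 1) * sph (\<lambda>x. x $ i * (partial i u x * q x))"
      using hpoly_sphere_parts[OF hpoly_mult[OF u' q]] by (simp add: hpoly_partial_mult[OF u' q])
    then show ?thesis
      using Suc by (simp add: sph_add cont)
  qed
  have "sph (\<lambda>x. lap u x * q x) + sph (\<lambda>x. \<Sum>i\<in>UNIV. partial i u x * partial i q x) =
      (\<Sum>i\<in>UNIV. sph (\<lambda>x. partial i (partial i u) x * q x) + sph (\<lambda>x. partial i u x * partial i q x))"
    by (simp add: lap_def sum_distrib_right sph_sum cont sum.distrib)
  also have "\<dots> = ?c * (\<Sum>i\<in>UNIV. sph (\<lambda>x. x $ i * (partial i u x * q x)))"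
    by (simp add: parts sum_distrib_left)
  also have "(\<Sum>i\<in>UNIV. sph (\<lambda>x. x $ i * (partial i u x * q x))) =
      sph (\<lambda>x. \<Sum>i\<in>UNIV. x $ i * (partial i u x * q x))"
    using hpoly_continuous_on[OF hpoly.coord[OF hpoly_mult[OF u' q]]] by (simp add: sph_sum)
  also have "(\<lambda>x. \<Sum>i\<in>UNIV. x $ i * (partial i u x * q x)) = (\<lambda>x. real j * (u x * q x))"
    by (simp add: euler_identity[OF u] flip: sum_distrib_right mult.assoc)
  finally show ?thesis
    by (simp add: sph_scale)
qed

text \<open>The gradient term is symmetric in \<open>u\<close> and \<open>q\<close>, so it cancels
  when \<open>sph_lap_mult\<close> is subtracted from its mirror image.\<close>

lemma sph_green:
  fixes u q :: "real ^ 'n \<Rightarrow> real"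
  assumes u: "hpoly j u" and q: "hpoly k q"
  shows "sph (\<lambda>x. lap u x * q x) - sph (\<lambda>x. u x * lap q x) =
    (real j - real k) * (real j + real k + real CARD('n) - 2) * sph (\<lambda>x. u x * q x)"
proof -
  have elim: "A - B = (a - b) * (a + b + d - 2) * S"
    if "A + C = a * (a + b + d - 2) * S" "B + C = b * (b + a + d - 2) * S" for A B C S a b d :: real
  proof -
    have "A - B = (A + C) - (B + C)"
      by simp
    then show ?thesis
      unfolding that by (simp add: algebra_simps)
  qed
  have swap: "(\<lambda>x. lap q x * u x) = (\<lambda>x. u x * lap q x)" "(\<lambda>x. q x * u x) = (\<lambda>x. u x * q x)"
    "(\<lambda>x. \<Sum>i\<in>UNIV. partial i q x * partial i u x) = (\<lambda>x. \<Sum>i\<in>UNIV. partial i u x * partial i q x)"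
    by (simp_all add: fun_eq_iff mult.commute)
  show ?thesis
    by (rule elim[OF sph_lap_mult[OF u q] sph_lap_mult[OF q u, unfolded swap]])
qed

subsection \<open>Moments of the radial weight\<close>

lemma continuous_powr_weight:
  assumes "a > 0"
  shows "continuous_on {-1..1} (\<lambda>t::real. (1 - t\<^sup>2) powr a)"
  by (intro continuous_on_powr' continuous_intros) (auto simp: assms abs_square_le_1)

lemma tendsto_powr_weight:
  assumes "a > 0"
  shows "((\<lambda>t::real. (1 - t\<^sup>2) powr a) \<longlongrightarrow> 0) (at_left 1)"
    and "((\<lambda>t::real. (1 - t\<^sup>2) powr a) \<longlongrightarrow> 0) (at_right (-1))"
proof -
  have "((\<lambda>t. (1 - t\<^sup>2) powr a) \<longlongrightarrow> (1 - s\<^sup>2) powr a) (at s within {-1..1})" if "s \<in> {-1..1}" for s :: real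
    using continuous_powr_weight[OF assms] that by (simp add: continuous_on_def)
  from this[of 1] this[of "-1"]
  show "((\<lambda>t::real. (1 - t\<^sup>2) powr a) \<longlongrightarrow> 0) (at_left 1)"
    and "((\<lambda>t::real. (1 - t\<^sup>2) powr a) \<longlongrightarrow> 0) (at_right (-1))"
    by (simp_all add: at_within_Icc_at_left at_within_Icc_at_right)
qed

lemma DERIV_powr_weight:
  assumes "\<bar>t\<bar> < 1"
  shows "((\<lambda>t::real. (1 - t\<^sup>2) powr a) has_real_derivative - 2 * a * t * (1 - t\<^sup>2) powr (a - 1)) (at t)"
proof -
  have "1 - t\<^sup>2 > 0"
    using assms by (simp add: abs_square_less_1)
  then show ?thesis
    by (auto intro!: derivative_eq_intros)
qed

lemma isCont_powr_weight:
  "\<bar>t\<bar> < 1 \<Longrightarrow> isCont (\<lambda>t::real. (1 - t\<^sup>2) powr a) t"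
  using DERIV_powr_weight DERIV_isCont by blast

text \<open>The factor \<open>t\<close> makes the weight elementary: \<open>-(1 - t^2)^a\<close> is
  an antiderivative of \<open>2 a t (1 - t^2)^(a - 1)\<close>. Since this is nonnegative on (0,1),
  finite boundary limits already give integrability at the singular end.\<close>

lemma integrable_weight_1:
  assumes a: "a > 0"
  shows "set_integrable lborel {-1..1} (\<lambda>t::real. \<bar>t\<bar> * (1 - t\<^sup>2) powr (a - 1))"
proof -
  define f where "f = (\<lambda>t::real. t * (1 - t\<^sup>2) powr (a - 1))"
  have "set_integrable lborel (einterval (ereal 0) (ereal 1)) (\<lambda>t. 2 * a * f t)"
  proof (rule interval_integral_FTC_nonneg)
    show "DERIV (\<lambda>t. - ((1 - t\<^sup>2) powr a)) t :> 2 * a * f t" if "ereal 0 < ereal t" "ereal t < ereal 1" for t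
      using DERIV_minus[OF DERIV_powr_weight[of t a]] that by (simp add: f_def mult.assoc)
    show "isCont (\<lambda>t. 2 * a * f t) t" if "ereal 0 < ereal t" "ereal t < ereal 1" for t
      unfolding f_def using that by (intro continuous_intros isCont_powr_weight) auto
    show "AE x in lborel. ereal 0 < ereal x \<longrightarrow> ereal x < ereal 1 \<longrightarrow> 0 \<le> 2 * a * f x"
      using a by (auto simp: f_def)
    have "isCont (\<lambda>t::real. - ((1 - t\<^sup>2) powr a)) 0"
      by (intro continuous_intros isCont_powr_weight) auto
    then have "((\<lambda>t::real. - ((1 - t\<^sup>2) powr a)) \<longlongrightarrow> - 1) (at_right 0)"
      by (simp add: isCont_def filterlim_at_split)
    then show "(((\<lambda>t. - ((1 - t\<^sup>2) powr a)) \<circ> real_of_ereal) \<longlongrightarrow> - 1) (at_right (ereal 0))"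
      by (simp add: ereal_tendsto_simps1)
    show "(((\<lambda>t. - ((1 - t\<^sup>2) powr a)) \<circ> real_of_ereal) \<longlongrightarrow> 0) (at_left (ereal 1))"
      using tendsto_minus[OF tendsto_powr_weight(1)[OF a]] by (simp add: ereal_tendsto_simps1)
  qed auto
  then have "set_integrable lborel {0<..<1} f"
    using a by simp
  then have int: "integrable lborel (\<lambda>t. indicator {0<..<1} t * f t)"
    by (simp add: set_integrable_def)
  \<comment> \<open>Reflection adds the half (-1,0). The remaining points 0, 1 and -1 agree because
    \<open>\<bar>t\<bar>\<close> vanishes at 0 and \<open>0 powr (a - 1)\<close> is 0.\<close>
  have "integrable lborel (\<lambda>t. indicator {0<..<1} t * f t + indicator {0<..<1} (- t) * f (- t))"
    using int lborel_integrable_real_affine[OF int, of "-1" 0] by simp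
  also have "(\<lambda>t. indicator {0<..<1} t * f t + indicator {0<..<1} (- t) * f (- t)) =
      (\<lambda>t. indicator {-1..1} t *\<^sub>R (\<bar>t\<bar> * (1 - t\<^sup>2) powr (a - 1)))"
  proof
    fix t :: real
    consider "t < -1" | "t = -1" | "-1 < t" "t < 0" | "t = 0" | "0 < t" "t < 1" | "t = 1" | "t > 1"
      by linarith
    then show "indicator {0<..<1} t * f t + indicator {0<..<1} (- t) * f (- t) =
        indicator {-1..1} t *\<^sub>R (\<bar>t\<bar> * (1 - t\<^sup>2) powr (a - 1))"
      by cases (auto simp: f_def)
  qed
  finally show ?thesis
    by (simp add: set_integrable_def)
qed

lemma integrable_weight:
  assumes a: "a > 0" and b: "b \<ge> 1"
  shows "set_integrable lborel {-1..1} (\<lambda>t::real. \<bar>t\<bar> ^ b * (1 - t\<^sup>2) powr (a - 1))"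
proof (rule set_integrable_bound[OF integrable_weight_1[OF a]])
  show "set_borel_measurable lborel {-1..1} (\<lambda>t::real. \<bar>t\<bar> ^ b * (1 - t\<^sup>2) powr (a - 1))"
    unfolding set_borel_measurable_def by measurable
  have "\<bar>t\<bar> ^ b \<le> \<bar>t\<bar>" if "t \<in> {-1..1}" for t :: real
    using power_decreasing[OF b, of "\<bar>t\<bar>"] that by auto
  then show "AE t::real in lborel. t \<in> {-1..1} \<longrightarrow> norm (\<bar>t\<bar> ^ b * (1 - t\<^sup>2) powr (a - 1)) \<le>
      norm (\<bar>t\<bar> * (1 - t\<^sup>2) powr (a - 1))"
    by (auto simp: abs_mult intro!: mult_right_mono)
qed

text \<open>Having one factor \<open>t\<close> outside the absolute value gives an antiderivative of
  an even power of \<open>\<bar>t\<bar>\<close> type across the origin, for either parity of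
  \<open>m\<close>; at 0 the quotient is \<open>\<bar>y\<bar> ^ m\<close>.\<close>

lemma DERIV_ident_abs_power:
  assumes "m \<ge> 1"
  shows "((\<lambda>t::real. t * \<bar>t\<bar> ^ m) has_real_derivative real (m + 1) * \<bar>t\<bar> ^ m) (at t)"
proof -
  consider "t > 0" | "t < 0" | "t = 0" by linarith
  then show ?thesis
  proof cases
    case 1
    have "((\<lambda>t. t ^ (m + 1)) has_real_derivative real (m + 1) * \<bar>t\<bar> ^ m) (at t)"
      using 1 DERIV_pow[of "m + 1" t] by simp
    then show ?thesis
      by (rule has_field_derivative_transform_within_open[where S = "{0<..}"]) (use 1 in auto)
  next
    case 2
    have "((\<lambda>s. s ^ (m + 1)) has_real_derivative real (m + 1) * (- t) ^ m) (at (- t))"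
      using DERIV_pow[of "m + 1" "- t"] by simp
    moreover have "(uminus has_real_derivative - 1) (at t)"
      by (auto intro!: derivative_eq_intros)
    ultimately have "((\<lambda>t. (- t) ^ (m + 1)) has_real_derivative (real (m + 1) * (- t) ^ m) * - 1) (at t)"
      by (rule DERIV_chain2)
    then have "((\<lambda>t. - ((- t) ^ (m + 1))) has_real_derivative - ((real (m + 1) * (- t) ^ m) * - 1)) (at t)"
      by (rule DERIV_minus)
    then have "((\<lambda>t. - ((- t) ^ (m + 1))) has_real_derivative real (m + 1) * \<bar>t\<bar> ^ m) (at t)"
      using 2 by simp
    then show ?thesis
      by (rule has_field_derivative_transform_within_open[where S = "{..<0}"]) (use 2 in auto)
  next
    case 3
    have "((\<lambda>y::real. y * \<bar>y\<bar> ^ m / y) \<longlongrightarrow> 0) (at 0)"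
    proof (rule Lim_null_comparison)
      show "\<forall>\<^sub>F y in at 0. norm (y * \<bar>y\<bar> ^ m / y) \<le> \<bar>y::real\<bar> ^ m"
        by (intro always_eventually) (auto simp: abs_mult)
      have "((\<lambda>y::real. \<bar>y\<bar> ^ m) \<longlongrightarrow> \<bar>0\<bar> ^ m) (at 0)"
        by (intro tendsto_intros)
      then show "((\<lambda>y::real. \<bar>y\<bar> ^ m) \<longlongrightarrow> 0) (at 0)"
        using assms by (simp add: zero_power)
    qed
    then show ?thesis
      using 3 assms by (simp add: has_field_derivative_iff zero_power)
  qed
qed

text \<open>Integrate the derivative of \<open>t * \<bar>t\<bar> ^ b * (1 - t^2)^a\<close> over
  [-1,1]: the boundary values vanish since \<open>a > 0\<close>, and splitting off one factor
  \<open>1 - t^2\<close> leaves the two moments.\<close>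

lemma weight_moment_recurrence:
  assumes a: "a > 0" and b: "b \<ge> 1"
  shows "(real b + 1) * (LINT t:{-1..1}|lborel. \<bar>t\<bar> ^ b * (1 - t\<^sup>2) powr (a - 1)) =
    (real b + 1 + 2 * a) * (LINT t:{-1..1}|lborel. \<bar>t\<bar> ^ (b + 2) * (1 - t\<^sup>2) powr (a - 1))"
proof -
  define w where "w = (\<lambda>t::real. (1 - t\<^sup>2) powr (a - 1))"
  define f where "f = (\<lambda>t. (real b + 1) * (\<bar>t\<bar> ^ b * w t) - (real b + 1 + 2 * a) * (\<bar>t\<bar> ^ (b + 2) * w t))"
  define F where "F = (\<lambda>t. t * \<bar>t\<bar> ^ b * (1 - t\<^sup>2) powr a)"
  have int: "set_integrable lborel {-1..1} (\<lambda>t. \<bar>t\<bar> ^ b * w t)"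
      "set_integrable lborel {-1..1} (\<lambda>t. \<bar>t\<bar> ^ (b + 2) * w t)"
    unfolding w_def using integrable_weight[OF a, of b] integrable_weight[OF a, of "b + 2"] b by auto
  have f: "set_integrable lborel {-1..1} f"
    unfolding f_def using int by (intro set_integral_diff set_integrable_mult_right) auto
  have "(LBINT t=ereal (-1)..ereal 1. f t) = 0 - 0"
  proof (rule interval_integral_FTC_integrable)
    show "(F has_vector_derivative f t) (at t)" if "ereal (-1) < ereal t" "ereal t < ereal 1" for t
    proof -
      have t: "\<bar>t\<bar> < 1"
        using that by auto
      then have "1 - t\<^sup>2 > 0"
        by (simp add: abs_square_less_1)
      then have "(1 - t\<^sup>2) powr a = (1 - t\<^sup>2) * w t"
        by (simp add: w_def powr_diff)
      moreover have "\<bar>t\<bar> ^ (b + 2) = \<bar>t\<bar> ^ b * t\<^sup>2"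
        by (simp only: power_add power2_abs)
      moreover have "real (b + 1) * P * ((1 - t\<^sup>2) * W) + - 2 * a * t * W * (t * P) =
          (real b + 1) * (P * W) - (real b + 1 + 2 * a) * (P * t\<^sup>2 * W)" for P W
        unfolding power2_eq_square by (simp add: algebra_simps)
      ultimately have "real (b + 1) * \<bar>t\<bar> ^ b * (1 - t\<^sup>2) powr a +
          - 2 * a * t * (1 - t\<^sup>2) powr (a - 1) * (t * \<bar>t\<bar> ^ b) = f t"
        by (simp only: f_def w_def)
      moreover have "(F has_real_derivative real (b + 1) * \<bar>t\<bar> ^ b * (1 - t\<^sup>2) powr a +
          - 2 * a * t * (1 - t\<^sup>2) powr (a - 1) * (t * \<bar>t\<bar> ^ b)) (at t)"
        unfolding F_def by (rule DERIV_mult[OF DERIV_ident_abs_power[OF b] DERIV_powr_weight[OF t]])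
      ultimately show ?thesis
        by (simp add: has_real_derivative_iff_has_vector_derivative)
    qed
    show "isCont f t" if "ereal (-1) < ereal t" "ereal t < ereal 1" for t
      unfolding f_def w_def using that by (intro continuous_intros isCont_powr_weight) auto
    show "set_integrable lborel (einterval (ereal (-1)) (ereal 1)) f"
      using f by (rule set_integrable_subset) auto
    have "((\<lambda>t. t * \<bar>t\<bar> ^ b) \<longlongrightarrow> 1 * \<bar>1\<bar> ^ b) (at_left (1::real))"
      by (intro tendsto_intros)
    from tendsto_mult[OF this tendsto_powr_weight(1)[OF a]]
    show "((F \<circ> real_of_ereal) \<longlongrightarrow> 0) (at_left (ereal 1))"
      by (simp add: ereal_tendsto_simps1 F_def)
    have "((\<lambda>t. t * \<bar>t\<bar> ^ b) \<longlongrightarrow> -1 * \<bar>-1\<bar> ^ b) (at_right (-1::real))"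
      by (intro tendsto_intros)
    from tendsto_mult[OF this tendsto_powr_weight(2)[OF a]]
    show "((F \<circ> real_of_ereal) \<longlongrightarrow> 0) (at_right (ereal (-1)))"
      by (simp add: ereal_tendsto_simps1 F_def del: uminus_ereal.simps)
  qed auto
  then have "(LINT t:{-1..1}|lborel. f t) = 0"
    using interval_integral_Icc[of "-1" 1 f] by simp
  then have "(real b + 1) * (LINT t:{-1..1}|lborel. \<bar>t\<bar> ^ b * w t) =
      (real b + 1 + 2 * a) * (LINT t:{-1..1}|lborel. \<bar>t\<bar> ^ (b + 2) * w t)"
    using int by (simp add: f_def)
  then show ?thesis
    by (simp only: w_def)
qed

subsection \<open>The differential operator of the ball\<close>

text \<open>The strict bound makes \<open>poly_lt 0\<close> the zero function alone, so test
  functions of degree at most \<open>n - 1\<close> are covered without subtraction, including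
  \<open>n = 0\<close>.\<close>

definition poly_lt :: "nat \<Rightarrow> (real ^ 'n \<Rightarrow> real) \<Rightarrow> bool" where
  "poly_lt n f \<longleftrightarrow> (\<exists>g. (\<forall>k. hpoly k (g k)) \<and> f = (\<lambda>x. \<Sum>k<n. g k x))"

lemma poly_ltI: "(\<And>k. hpoly k (g k)) \<Longrightarrow> poly_lt n (\<lambda>x. \<Sum>k<n. g k x)"
  unfolding poly_lt_def by blast

lemma hpoly_poly_lt:
  assumes "hpoly k f" "k < n"
  shows "poly_lt n f"
proof -
  have "poly_lt n (\<lambda>x. \<Sum>j<n. (if j = k then f else (\<lambda>_. 0)) x)"
    using assms by (intro poly_ltI) (auto simp: hpoly_zero)
  also have "(\<lambda>x. \<Sum>j<n. (if j = k then f else (\<lambda>_. 0)) x) = f"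
    using assms by (simp add: if_distribR)
  finally show ?thesis .
qed

lemma poly_lt_zero: "poly_lt n (\<lambda>_. 0)"
  using poly_ltI[OF hpoly_zero, of n] by simp

lemma poly_lt_add:
  assumes "poly_lt n f" "poly_lt n g"
  shows "poly_lt n (\<lambda>x. f x + g x)"
proof -
  obtain F G where "\<And>k. hpoly k (F k)" "f = (\<lambda>x. \<Sum>k<n. F k x)"
      "\<And>k. hpoly k (G k)" "g = (\<lambda>x. \<Sum>k<n. G k x)"
    using assms unfolding poly_lt_def by blast
  then show ?thesis
    using poly_ltI[of "\<lambda>k x. F k x + G k x" n] by (simp add: hpoly.add sum.distrib)
qed

lemma poly_lt_sum: "(\<And>i. i \<in> A \<Longrightarrow> poly_lt n (f i)) \<Longrightarrow> poly_lt n (\<lambda>x. \<Sum>i\<in>A. f i x)"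
  by (induction A rule: infinite_finite_induct) (auto intro: poly_lt_zero poly_lt_add)

lemma poly_lt_mult:
  assumes "poly_lt m f" "poly_lt n g"
  shows "poly_lt (m + n) (\<lambda>x. f x * g x)"
proof -
  obtain F G where FG: "\<And>k. hpoly k (F k)" "f = (\<lambda>x. \<Sum>k<m. F k x)"
      "\<And>k. hpoly k (G k)" "g = (\<lambda>x. \<Sum>k<n. G k x)"
    using assms unfolding poly_lt_def by blast
  have "poly_lt (m + n) (\<lambda>x. F j x * G k x)" if "j < m" "k < n" for j k
    using that by (intro hpoly_poly_lt[OF hpoly_mult[OF FG(1) FG(3)]]) auto
  then have "poly_lt (m + n) (\<lambda>x. \<Sum>j<m. \<Sum>k<n. F j x * G k x)"
    by (intro poly_lt_sum) auto
  then show ?thesis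
    by (simp add: FG sum_product)
qed

lemma poly_lt_continuous:
  assumes "poly_lt n f"
  shows "continuous_on A f"
proof -
  obtain g where g: "\<And>k. hpoly k (g k)" "f = (\<lambda>x. \<Sum>k<n. g k x)"
    using assms unfolding poly_lt_def by blast
  show ?thesis
    unfolding g(2) by (intro continuous_on_sum hpoly_continuous_on[OF g(1)])
qed

lemma poly_lt_continuous_scaleR:
  assumes "poly_lt n f"
  shows "continuous_on A (\<lambda>x. f (c *\<^sub>R x))"
  by (rule continuous_on_compose2[OF poly_lt_continuous[OF assms, of UNIV]]) (auto intro: continuous_intros)

text \<open>Integrating out the sphere leaves a polynomial in the radius, from which integrability
  and continuity of the radial integrands follow.\<close>

lemma poly_lt_sph:
  assumes "poly_lt n f"
  shows "\<exists>c. \<forall>r. sph (\<lambda>\<xi>. f (r *\<^sub>R \<xi>)) = (\<Sum>k<n. c k * r ^ k)"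
proof -
  obtain g where g: "\<And>k. hpoly k (g k)" "f = (\<lambda>x. \<Sum>k<n. g k x)"
    using assms unfolding poly_lt_def by blast
  have "sph (\<lambda>\<xi>. f (r *\<^sub>R \<xi>)) = (\<Sum>k<n. sph (g k) * r ^ k)" for r
  proof -
    have "sph (\<lambda>\<xi>. f (r *\<^sub>R \<xi>)) = sph (\<lambda>\<xi>. \<Sum>k<n. r ^ k * g k \<xi>)"
      by (simp add: g(2) hpoly_scaleR[OF g(1)])
    also have "\<dots> = (\<Sum>k<n. sph (\<lambda>\<xi>. r ^ k * g k \<xi>))"
      by (intro sph_sum continuous_intros hpoly_continuous_on[OF g(1)])
    also have "\<dots> = (\<Sum>k<n. sph (g k) * r ^ k)"
      by (simp add: sph_scale mult.commute)
    finally show ?thesis .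
  qed
  then show ?thesis
    by (intro exI[of _ "\<lambda>k. sph (g k)"] allI)
qed

section \<open>Weighted integrals over the ball and symmetry of the operator\<close>

definition moment :: "real \<Rightarrow> nat \<Rightarrow> real" where
  "moment \<gamma> b = (LINT t:{-1..1}|lborel. \<bar>t\<bar> ^ b * (1 - t\<^sup>2) powr (\<gamma> - 1 / 2))"

text \<open>In polar coordinates this is twice the integral of \<open>f\<close> over the unit ball
  with weight \<open>(1 - |x|^2)\<close> to the power \<gamma> - 1/2: both nappes of the cone
  project onto the ball. Keeping \<open>t\<close> in [-1,1] matches \<open>cone_integral\<close>
  without a constant.\<close>

definition ball_integral :: "real \<Rightarrow> (real ^ 'n \<Rightarrow> real) \<Rightarrow> real" where
  "ball_integral \<gamma> f = (LINT t:{-1..1}|lborel.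
     \<bar>t\<bar> ^ (CARD('n) - 1) * ((1 - t\<^sup>2) powr (\<gamma> - 1 / 2) * sph (\<lambda>\<xi>. f (\<bar>t\<bar> *\<^sub>R \<xi>))))"

lemma moment_integrable:
  fixes \<gamma> :: real
  assumes "\<gamma> > - 1 / 2" "b \<ge> 1"
  shows "set_integrable lborel {-1..1} (\<lambda>t. \<bar>t\<bar> ^ b * (1 - t\<^sup>2) powr (\<gamma> - 1 / 2))"
  using integrable_weight[of "\<gamma> + 1 / 2" b] assms by simp

lemma moment_recurrence:
  assumes "\<gamma> > - 1 / 2" "b \<ge> 1"
  shows "(real b + 1) * moment \<gamma> b = (real b + 2 + 2 * \<gamma>) * moment \<gamma> (b + 2)"
  using weight_moment_recurrence[of "\<gamma> + 1 / 2" b] assms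
  by (simp add: moment_def add.commute[of 2] add.assoc)

lemma ball_integrable:
  fixes f :: "real ^ 'n \<Rightarrow> real"
  assumes \<gamma>: "\<gamma> > - 1 / 2" and d: "CARD('n) \<ge> 2" and f: "poly_lt n f"
  shows "set_integrable lborel {-1..1}
    (\<lambda>t. \<bar>t\<bar> ^ (CARD('n) - 1) * ((1 - t\<^sup>2) powr (\<gamma> - 1 / 2) * sph (\<lambda>\<xi>. f (\<bar>t\<bar> *\<^sub>R \<xi>))))"
proof -
  obtain c where c: "\<And>r. sph (\<lambda>\<xi>. f (r *\<^sub>R \<xi>)) = (\<Sum>k<n. c k * r ^ k)"
    using poly_lt_sph[OF f] by blast
  have "set_integrable lborel {-1..1}
      (\<lambda>t. c k * (\<bar>t\<bar> ^ (CARD('n) - 1 + k) * (1 - t\<^sup>2) powr (\<gamma> - 1 / 2)))" for k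
    using \<gamma> d by (intro set_integrable_mult_right moment_integrable) auto
  then have "set_integrable lborel {-1..1}
      (\<lambda>t. \<Sum>k<n. c k * (\<bar>t\<bar> ^ (CARD('n) - 1 + k) * (1 - t\<^sup>2) powr (\<gamma> - 1 / 2)))"
    unfolding set_integrable_def scaleR_sum_right by (intro Bochner_Integration.integrable_sum)
  then show ?thesis
    unfolding c sum_distrib_left power_add by (simp only: mult_ac)
qed

lemma ball_integral_hpoly:
  fixes f :: "real ^ 'n \<Rightarrow> real"
  assumes "hpoly k f"
  shows "ball_integral \<gamma> f = moment \<gamma> (CARD('n) - 1 + k) * sph f"
proof -
  have "ball_integral \<gamma> f = (LINT t:{-1..1}|lborel.
      (\<bar>t\<bar> ^ (CARD('n) - 1 + k) * (1 - t\<^sup>2) powr (\<gamma> - 1 / 2)) * sph f)"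
    unfolding ball_integral_def hpoly_scaleR[OF assms] sph_scale power_add by (simp only: mult_ac)
  then show ?thesis
    by (simp add: moment_def)
qed

lemma ball_integral_add:
  fixes f g :: "real ^ 'n \<Rightarrow> real"
  assumes \<gamma>: "\<gamma> > - 1 / 2" and d: "CARD('n) \<ge> 2" and f: "poly_lt m f" and g: "poly_lt n g"
  shows "ball_integral \<gamma> (\<lambda>x. f x + g x) = ball_integral \<gamma> f + ball_integral \<gamma> g"
  using ball_integrable[OF \<gamma> d f] ball_integrable[OF \<gamma> d g]
    poly_lt_continuous_scaleR[OF f] poly_lt_continuous_scaleR[OF g]
  by (simp add: ball_integral_def sph_add distrib_left)

lemma ball_integral_zero: "ball_integral \<gamma> (\<lambda>_. 0) = 0"
  by (simp add: ball_integral_def sph_def)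

lemma ball_integral_scale: "ball_integral \<gamma> (\<lambda>x. c * f x) = c * ball_integral \<gamma> f"
proof -
  have "ball_integral \<gamma> (\<lambda>x. c * f x) = (LINT t:{-1..1}|lborel.
     c * (\<bar>t\<bar> ^ (CARD('n) - 1) * ((1 - t\<^sup>2) powr (\<gamma> - 1 / 2) * sph (\<lambda>\<xi>. f (\<bar>t\<bar> *\<^sub>R \<xi>)))))"
    for f :: "real ^ 'n \<Rightarrow> real"
    unfolding ball_integral_def sph_scale by (simp only: mult_ac)
  then show ?thesis
    by (simp add: ball_integral_def)
qed

lemma ball_integral_sum:
  fixes f :: "'a \<Rightarrow> real ^ 'n \<Rightarrow> real"
  assumes \<gamma>: "\<gamma> > - 1 / 2" and d: "CARD('n) \<ge> 2" and f: "\<And>i. i \<in> A \<Longrightarrow> poly_lt n (f i)"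
  shows "ball_integral \<gamma> (\<lambda>x. \<Sum>i\<in>A. f i x) = (\<Sum>i\<in>A. ball_integral \<gamma> (f i))"
  using f
proof (induction A rule: infinite_finite_induct)
  case (insert a A)
  then show ?case
    using ball_integral_add[OF \<gamma> d, of n "f a" n "\<lambda>x. \<Sum>i\<in>A. f i x"] by (simp add: poly_lt_sum)
qed (simp_all add: ball_integral_zero)

text \<open>\<open>lap u - eigval j u\<close> is the ball operator
  \<open>\<Delta> - \<langle>x, \<nabla>\<rangle>\<^sup>2 - (2\<gamma> + d - 1) \<langle>x, \<nabla>\<rangle>\<close> applied to \<open>u\<close> homogeneous of degree \<open>j\<close>.\<close>

definition eigval :: "real \<Rightarrow> real \<Rightarrow> nat \<Rightarrow> real" where
  "eigval \<gamma> d k = real k * (real k + 2 * \<gamma> + d - 1)"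

text \<open>Green's identity gives the difference of the Laplacian terms with moment
  \<open>b\<close>, the integral of \<open>u q\<close> has moment \<open>b + 2\<close>, and the
  recurrence converts one into the other, producing \<open>eigval j - eigval k\<close>.\<close>

lemma ball_operator_symmetric:
  fixes u q :: "real ^ 'n \<Rightarrow> real"
  assumes \<gamma>: "\<gamma> > - 1 / 2" and d: "CARD('n) \<ge> 2" and u: "hpoly j u" and q: "hpoly k q"
  shows "ball_integral \<gamma> (\<lambda>x. lap u x * q x) - eigval \<gamma> (real CARD('n)) j * ball_integral \<gamma> (\<lambda>x. u x * q x) =
    ball_integral \<gamma> (\<lambda>x. u x * lap q x) - eigval \<gamma> (real CARD('n)) k * ball_integral \<gamma> (\<lambda>x. u x * q x)"
proof (cases "j + k \<ge> 2")
  case True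
  let ?d = "CARD('n)"
  define b where "b = ?d - 1 + (j + k - 2)"
  \<comment> \<open>The degree \<open>j + k - 2\<close> also holds when \<open>j < 2\<close>: then
    \<open>lap u\<close> is zero, which is homogeneous of every degree.\<close>
  have lap_u: "hpoly (j + k - 2) (\<lambda>x. lap u x * q x)"
  proof (cases "j < 2")
    case False
    then show ?thesis
      using hpoly_mult[OF hpoly_lap[OF u] q] by simp
  qed (simp add: lap_eq_0[OF u] hpoly_zero)
  have lap_q: "hpoly (j + k - 2) (\<lambda>x. u x * lap q x)"
  proof (cases "k < 2")
    case False
    then show ?thesis
      using hpoly_mult[OF u hpoly_lap[OF q]] by simp
  qed (simp add: lap_eq_0[OF q] hpoly_zero)
  have b: "real b + 1 = real j + real k + real ?d - 2" "?d - 1 + (j + k) = b + 2" "b \<ge> 1"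
    using True d by (auto simp: b_def of_nat_diff)
  define A B S M M' where "A = sph (\<lambda>x. lap u x * q x)" and "B = sph (\<lambda>x. u x * lap q x)"
    and "S = sph (\<lambda>x. u x * q x)" and "M = moment \<gamma> b" and "M' = moment \<gamma> (b + 2)"
  have int: "ball_integral \<gamma> (\<lambda>x. lap u x * q x) = M * A"
    "ball_integral \<gamma> (\<lambda>x. u x * lap q x) = M * B"
    "ball_integral \<gamma> (\<lambda>x. u x * q x) = M' * S"
    using ball_integral_hpoly[OF lap_u, of \<gamma>] ball_integral_hpoly[OF lap_q, of \<gamma>]
      ball_integral_hpoly[OF hpoly_mult[OF u q], of \<gamma>]
    unfolding A_def B_def S_def M_def M'_def b(2) by (simp_all only: b_def)
  have "A - B = (real j - real k) * (real j + real k + real ?d - 2) * S"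
    unfolding A_def B_def S_def by (rule sph_green[OF u q])
  then have "M * A - M * B = M * ((real j - real k) * (real j + real k + real ?d - 2) * S)"
    by (simp only: right_diff_distrib[symmetric])
  also have "\<dots> = (real j - real k) * S * ((real b + 1) * M)"
    unfolding b(1) by (simp only: mult_ac)
  also have "(real b + 1) * M = (real b + 2 + 2 * \<gamma>) * M'"
    using moment_recurrence[OF \<gamma> b(3)] by (simp add: M_def M'_def)
  also have "real b + 2 + 2 * \<gamma> = real j + real k + 2 * \<gamma> + real ?d - 1"
    using b(1) by simp
  finally show ?thesis
    unfolding int eigval_def by (simp add: algebra_simps)
next
  case False
  then have zero: "lap u = (\<lambda>_. 0)" "lap q = (\<lambda>_. 0)"
    using lap_eq_0[OF u] lap_eq_0[OF q] by auto
  show ?thesis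
  proof (cases "j = k")
    case False
    with \<open>\<not> 2 \<le> j + k\<close> have "j + k = 1" "real j \<noteq> real k"
      by auto
    then have "real j + real k = 1"
      by (metis of_nat_1 of_nat_add)
    \<comment> \<open>Both Laplacians vanish, so Green's identity says that
      \<open>(j - k) (d - 1) * sph (u q)\<close> is zero, with \<open>j - k\<close> equal to 1 or -1
      and \<open>d - 1\<close> positive.\<close>
    with sph_green[OF u q] \<open>real j \<noteq> real k\<close> d have "sph (\<lambda>x. u x * q x) = 0"
      by (simp add: zero sph_def)
    then show ?thesis
      by (simp add: zero ball_integral_hpoly[OF hpoly_mult[OF u q]])
  qed (simp add: zero)
qed

section \<open>Definiteness of the weighted form\<close>

lemma integral_zero_imp_zero_on_open:
  fixes f :: "'a::euclidean_space \<Rightarrow> real"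
  assumes "open S" and cont: "continuous_on S f"
    and nonneg: "\<And>x. x \<in> S \<Longrightarrow> 0 \<le> f x"
    and int: "set_integrable lborel S f" and zero: "(LINT x:S|lborel. f x) = 0"
    and "x \<in> S"
  shows "f x = 0"
proof -
  have "AE x in lborel. indicator S x *\<^sub>R f x = 0"
    using integral_nonneg_eq_0_iff_AE[of lborel "\<lambda>x. indicator S x *\<^sub>R f x"] int zero nonneg
    by (auto simp: set_integrable_def set_lebesgue_integral_def indicator_def)
  then have AE: "AE x in lborel. \<not> (x \<in> S \<and> f x \<noteq> 0)"
    by (rule AE_mp) (auto intro!: AE_I2)
  define T where "T = S \<inter> f -` (- {0})"
  have "open T"
    unfolding T_def by (rule continuous_open_preimage[OF cont \<open>open S\<close>]) auto
  moreover have "T \<in> null_sets lborel"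
    using AE \<open>open T\<close> by (subst AE_iff_null_sets) (auto simp: T_def)
  then have "negligible T"
    by (simp add: negligible_iff_null_sets null_sets_completion_iff null_sets_completionI)
  ultimately have "T = {}"
    using open_not_negligible by blast
  with \<open>x \<in> S\<close> show ?thesis
    by (auto simp: T_def)
qed

lemma sph_square_eq_0:
  fixes f :: "real ^ 'n \<Rightarrow> real"
  assumes cont: "continuous_on UNIV f" and zero: "sph (\<lambda>x. (f x)\<^sup>2) = 0" and "norm \<xi> = 1"
  shows "f \<xi> = 0"
proof -
  let ?S = "ball 0 1 - {0 :: real ^ 'n}"
  obtain C where C: "\<And>x. norm x \<le> 1 \<Longrightarrow> \<bar>(f x)\<^sup>2\<bar> \<le> C"
    using continuous_bound_cball[of "\<lambda>x. (f x)\<^sup>2" 1] cont by (auto intro: continuous_intros)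
  have meas: "(\<lambda>x. (f x)\<^sup>2) \<in> borel_measurable borel"
    using cont by (intro borel_measurable_continuous_onI continuous_intros)
  \<comment> \<open>Half of \<xi> is an interior point of the punctured ball on the ray through
    \<xi>, where the ray-constant extension is continuous.\<close>
  have "(f (sgn ((1 / 2) *\<^sub>R \<xi>)))\<^sup>2 = 0"
  proof (rule integral_zero_imp_zero_on_open[where S = ?S and f = "\<lambda>x. (f (sgn x))\<^sup>2"])
    show "continuous_on ?S (\<lambda>x. (f (sgn x))\<^sup>2)"
      unfolding sgn_div_norm
      by (intro continuous_intros continuous_on_compose2[OF cont]) auto
    have "emeasure lborel ?S \<le> emeasure lborel (cball 0 1 :: (real ^ 'n) set)"
      by (rule emeasure_mono) auto
    also have "\<dots> < \<infinity>"
      by (rule emeasure_lborel_cball_finite)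
    finally have "set_integrable lborel ?S (\<lambda>x. C)"
      unfolding set_integrable_def by (intro integrable_scaleR_left integrable_real_indicator) auto
    then show "set_integrable lborel ?S (\<lambda>x. (f (sgn x))\<^sup>2)"
    proof (rule set_integrable_bound)
      have "(\<lambda>x. (f (sgn x))\<^sup>2) \<in> borel_measurable borel"
        using measurable_compose[OF sgn_measurable_vec meas] .
      then show "set_borel_measurable lborel ?S (\<lambda>x. (f (sgn x))\<^sup>2)"
        unfolding set_borel_measurable_def by (intro borel_measurable_scaleR borel_measurable_indicator) auto
      have "\<bar>(f (sgn x))\<^sup>2\<bar> \<le> C" for x
        by (rule C) (simp add: norm_sgn)
      then show "AE x in lborel. x \<in> ?S \<longrightarrow> norm ((f (sgn x))\<^sup>2) \<le> norm C"
        by (intro AE_I2) (smt (verit, best) real_norm_def)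
    qed
    show "(LINT x:?S|lborel. (f (sgn x))\<^sup>2) = 0"
      using zero sph_eq_ball_integral[OF meas] by simp
    show "(1 / 2) *\<^sub>R \<xi> \<in> ?S"
      using \<open>norm \<xi> = 1\<close> by auto
  qed (auto intro: open_delete)
  moreover have "sgn ((1 / 2) *\<^sub>R \<xi>) = \<xi>"
    using \<open>norm \<xi> = 1\<close> by (simp add: sgn_div_norm)
  ultimately show ?thesis
    by simp
qed

text \<open>Vanishing is obtained in two stages: for almost all radii, hence by continuity for all
  with \<open>0 < r < 1\<close>, the sphere integral of the square is zero, and then so is
  \<open>f\<close> on each such sphere.\<close>

lemma ball_integral_definite:
  fixes f :: "real ^ 'n \<Rightarrow> real"
  assumes \<gamma>: "\<gamma> > - 1 / 2" and d: "CARD('n) \<ge> 2" and f: "poly_lt n f"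
    and zero: "ball_integral \<gamma> (\<lambda>x. f x * f x) = 0"
    and x: "norm x \<le> 1"
  shows "f x = 0"
proof -
  let ?S = "{0<..<1} \<union> {-1<..<0} :: real set"
  define Q where "Q = (\<lambda>r. sph (\<lambda>\<xi>. (f (r *\<^sub>R \<xi>))\<^sup>2))"
  define w where "w = (\<lambda>t::real. \<bar>t\<bar> ^ (CARD('n) - 1) * (1 - t\<^sup>2) powr (\<gamma> - 1 / 2))"
  have ff: "poly_lt (n + n) (\<lambda>x. f x * f x)"
    by (rule poly_lt_mult[OF f f])
  obtain c where c: "\<And>r. Q r = (\<Sum>k<n + n. c k * r ^ k)"
    using poly_lt_sph[OF ff] by (auto simp: Q_def power2_eq_square)
  have Q_nonneg: "Q r \<ge> 0" for r
    by (simp add: Q_def sph_def)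
  have w_pos: "w t > 0" if "t \<in> ?S" for t
  proof -
    have "\<bar>t\<bar> < 1" "t \<noteq> 0"
      using that by auto
    then show ?thesis
      using abs_square_less_1[of t] by (simp add: w_def)
  qed
  \<comment> \<open>Passing to the open set \<open>?S\<close> changes nothing: the integrand is 0 at
    \<open>t = 0\<close> because \<open>d - 1\<close> is positive, and at 1 and -1 because
    \<open>0 powr _\<close> is 0.\<close>
  have ind: "indicator {-1..1} t *\<^sub>R
      (\<bar>t\<bar> ^ (CARD('n) - 1) * ((1 - t\<^sup>2) powr (\<gamma> - 1 / 2) * sph (\<lambda>\<xi>. f (\<bar>t\<bar> *\<^sub>R \<xi>) * f (\<bar>t\<bar> *\<^sub>R \<xi>)))) =
      indicator ?S t *\<^sub>R (w t * Q \<bar>t\<bar>)" for t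
  proof (cases "t \<in> ?S")
    case False
    then consider "t = 0" | "t = 1" | "t = -1" | "t > 1" | "t < -1"
      by fastforce
    then show ?thesis
      using d by cases auto
  qed (auto simp: w_def Q_def power2_eq_square)
  have Q0: "Q \<bar>t\<bar> = 0" if "t \<in> ?S" for t
  proof -
    have "w t * Q \<bar>t\<bar> = 0"
    proof (rule integral_zero_imp_zero_on_open[where S = ?S and f = "\<lambda>t. w t * Q \<bar>t\<bar>"])
      show "continuous_on ?S (\<lambda>t. w t * Q \<bar>t\<bar>)"
        unfolding w_def c by (intro continuous_intros) (auto simp: power2_eq_1_iff)
      show "set_integrable lborel ?S (\<lambda>t. w t * Q \<bar>t\<bar>)"
        using ball_integrable[OF \<gamma> d ff] unfolding set_integrable_def ind .
      show "(LINT t:?S|lborel. w t * Q \<bar>t\<bar>) = 0"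
        using zero unfolding ball_integral_def set_lebesgue_integral_def ind .
      show "0 \<le> w t * Q \<bar>t\<bar>" if "t \<in> ?S" for t
        using w_pos[OF that] Q_nonneg by (simp add: less_imp_le)
    qed (use that in auto)
    then show ?thesis
      using w_pos[OF that] by simp
  qed
  have zero_on: "f (r *\<^sub>R \<xi>) = 0" if "r \<in> {0<..<1}" "norm \<xi> = 1" for r \<xi>
    using sph_square_eq_0[of "\<lambda>\<xi>. f (r *\<^sub>R \<xi>)" \<xi>] poly_lt_continuous_scaleR[OF f] Q0[of r] that
    by (simp add: Q_def)
  obtain \<xi> r where \<xi>: "norm \<xi> = 1" "x = r *\<^sub>R \<xi>" "r \<in> {0..1}"
  proof (cases "x = 0")
    case True
    then show ?thesis
      using that[of "axis undefined 1" 0] by simp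
  next
    case False
    then show ?thesis
      using that[of "sgn x" "norm x"] x by (simp add: norm_sgn sgn_div_norm)
  qed
  \<comment> \<open>Continuity along the ray adds the centre and the boundary sphere.\<close>
  have "continuous_on (closure {0<..<1}) (\<lambda>r. f (r *\<^sub>R \<xi>))"
    by (intro continuous_on_compose2[OF poly_lt_continuous[OF f, of UNIV]] continuous_intros) auto
  then have "f (r *\<^sub>R \<xi>) = 0"
    by (rule continuous_constant_on_closure) (use \<xi> zero_on in auto)
  with \<xi> show ?thesis
    by simp
qed

text \<open>The sum is a residual \<open>R\<close> of degree below \<open>n\<close>, since the
  coefficient of the top part cancels. By symmetry the form of \<open>R\<close> with itself is that
  of the given polynomial with the shifted operator applied to \<open>R\<close>, again of degree
  below \<open>n\<close>; orthogonality makes it zero, and definiteness gives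
  \<open>R = 0\<close>.\<close>

lemma ball_operator_eigenfunction:
  fixes h :: "nat \<Rightarrow> real ^ 'n \<Rightarrow> real"
  assumes \<gamma>: "\<gamma> > - 1 / 2" and d: "CARD('n) \<ge> 2" and h: "\<And>k. hpoly k (h k)"
    and orth: "\<And>q. poly_lt n q \<Longrightarrow> ball_integral \<gamma> (\<lambda>x. (\<Sum>k<Suc n. h k x) * q x) = 0"
    and x: "norm x \<le> 1"
  shows "(\<Sum>k<Suc n. lap (h k) x + (eigval \<gamma> (real CARD('n)) n - eigval \<gamma> (real CARD('n)) k) * h k x) = 0"
proof -
  define e where "e = eigval \<gamma> (real CARD('n))"
  define L where "L = (\<lambda>k u x. lap u x + (e n - e k) * (u :: real ^ 'n \<Rightarrow> real) x)"
  \<comment> \<open>The alternative with \<open>m = n\<close> admits \<open>k = n\<close>: there the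
    factor \<open>e n - e k\<close> is zero and only the Laplacian, of lower degree,
    remains.\<close>
  have L_lt: "poly_lt m (L k u)" if u: "hpoly k u" and k: "k < m \<or> k \<le> n \<and> m = n" for k m u
  proof -
    have "poly_lt m (lap u)"
    proof (cases "k < 2")
      case True
      then show ?thesis
        by (simp add: lap_eq_0[OF u] poly_lt_zero)
    qed (use k in \<open>auto intro!: hpoly_poly_lt[OF hpoly_lap[OF u]]\<close>)
    moreover have "poly_lt m (\<lambda>x. (e n - e k) * u x)"
    proof (cases "k < m")
      case True
      then show ?thesis
        by (intro hpoly_poly_lt[OF hpoly_scale[OF u]])
    qed (use k in \<open>auto simp: poly_lt_zero\<close>)
    ultimately show ?thesis
      unfolding L_def by (rule poly_lt_add)
  qed
  define R where "R = (\<lambda>x. \<Sum>k<Suc n. L k (h k) x)"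
  have R: "poly_lt n R"
    unfolding R_def by (intro poly_lt_sum L_lt h) auto
  have L_sym: "ball_integral \<gamma> (\<lambda>x. L j u x * q x) = ball_integral \<gamma> (\<lambda>x. u x * L k q x)"
    if u: "hpoly j u" and q: "hpoly k q" for j k u q
  proof -
    have uq: "poly_lt (Suc (j + k)) (\<lambda>x. c * (u x * q x))" for c
      by (intro hpoly_poly_lt[OF hpoly_scale[OF hpoly_mult[OF u q]]]) simp
    have "ball_integral \<gamma> (\<lambda>x. L j u x * q x) =
        ball_integral \<gamma> (\<lambda>x. lap u x * q x + (e n - e j) * (u x * q x))"
      by (simp add: L_def distrib_right mult.assoc)
    also have "\<dots> = ball_integral \<gamma> (\<lambda>x. lap u x * q x) + (e n - e j) * ball_integral \<gamma> (\<lambda>x. u x * q x)"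
      by (subst ball_integral_add[OF \<gamma> d hpoly_poly_lt[OF hpoly_mult[OF hpoly_lap[OF u] q] lessI] uq])
        (simp add: ball_integral_scale)
    also have "\<dots> = ball_integral \<gamma> (\<lambda>x. u x * lap q x) + (e n - e k) * ball_integral \<gamma> (\<lambda>x. u x * q x)"
      using ball_operator_symmetric[OF \<gamma> d u q] by (simp add: e_def left_diff_distrib)
    also have "\<dots> = ball_integral \<gamma> (\<lambda>x. u x * lap q x + (e n - e k) * (u x * q x))"
      by (subst ball_integral_add[OF \<gamma> d hpoly_poly_lt[OF hpoly_mult[OF u hpoly_lap[OF q]] lessI] uq])
        (simp add: ball_integral_scale)
    also have "\<dots> = ball_integral \<gamma> (\<lambda>x. u x * L k q x)"
      by (simp add: L_def distrib_left mult.left_commute)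
    finally show ?thesis .
  qed
  have int: "ball_integral \<gamma> (\<lambda>x. (\<Sum>j<m. f j x) * (\<Sum>k<l. g k x)) =
      (\<Sum>j<m. \<Sum>k<l. ball_integral \<gamma> (\<lambda>x. f j x * g k x))"
    if f: "\<And>j. j < m \<Longrightarrow> poly_lt (Suc n) (f j)" and g: "\<And>k. k < l \<Longrightarrow> poly_lt (Suc n) (g k)"
    for m l and f g :: "nat \<Rightarrow> real ^ 'n \<Rightarrow> real"
  proof -
    have fg: "poly_lt (Suc n + Suc n) (\<lambda>x. f j x * g k x)" if "j < m" "k < l" for j k
      using that by (intro poly_lt_mult f g)
    have "ball_integral \<gamma> (\<lambda>x. (\<Sum>j<m. f j x) * (\<Sum>k<l. g k x)) =
        ball_integral \<gamma> (\<lambda>x. \<Sum>j<m. \<Sum>k<l. f j x * g k x)"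
      by (simp add: sum_product)
    also have "\<dots> = (\<Sum>j<m. ball_integral \<gamma> (\<lambda>x. \<Sum>k<l. f j x * g k x))"
      using fg by (intro ball_integral_sum[OF \<gamma> d] poly_lt_sum) auto
    also have "\<dots> = (\<Sum>j<m. \<Sum>k<l. ball_integral \<gamma> (\<lambda>x. f j x * g k x))"
      using fg by (intro sum.cong refl ball_integral_sum[OF \<gamma> d]) auto
    finally show ?thesis .
  qed
  obtain g where g: "\<And>k. hpoly k (g k)" "R = (\<lambda>x. \<Sum>k<n. g k x)"
    using R unfolding poly_lt_def by blast
  \<comment> \<open>This is the operator applied to \<open>R\<close> component by component, each
    component with the eigenvalue of its own degree.\<close>
  define q where "q = (\<lambda>x. \<Sum>k<n. L k (g k) x)"
  have "R x * R x = (\<Sum>j<Suc n. L j (h j) x) * (\<Sum>k<n. g k x)" for x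
    using fun_cong[OF g(2), of x] fun_cong[OF R_def, of x] by simp
  then have "ball_integral \<gamma> (\<lambda>x. R x * R x) = ball_integral \<gamma> (\<lambda>x. (\<Sum>j<Suc n. L j (h j) x) * (\<Sum>k<n. g k x))"
    by (rule arg_cong[OF ext])
  also have "\<dots> = (\<Sum>j<Suc n. \<Sum>k<n. ball_integral \<gamma> (\<lambda>x. L j (h j) x * g k x))"
    by (intro int L_lt h hpoly_poly_lt[OF g(1)]) auto
  also have "\<dots> = (\<Sum>j<Suc n. \<Sum>k<n. ball_integral \<gamma> (\<lambda>x. h j x * L k (g k) x))"
    by (intro sum.cong refl L_sym h g)
  also have "\<dots> = ball_integral \<gamma> (\<lambda>x. (\<Sum>j<Suc n. h j x) * q x)"
    unfolding q_def by (intro int[symmetric] L_lt g hpoly_poly_lt[OF h]) auto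
  also have "\<dots> = 0"
    unfolding q_def by (intro orth poly_lt_sum L_lt g) auto
  finally have "R x = 0"
    by (rule ball_integral_definite[OF \<gamma> d R _ x])
  then show ?thesis
    by (simp add: R_def L_def e_def)
qed

subsection \<open>Polynomials on the cone\<close>

abbreviation exponents :: "nat \<Rightarrow> (('n::finite \<Rightarrow> nat) \<times> nat) set" where
  "exponents n \<equiv> {(\<alpha>, k). (\<Sum>i\<in>UNIV. \<alpha> i) + k \<le> n}"

lemma polynomial_monomial:
  assumes "(\<Sum>i\<in>UNIV. \<alpha> i) + k \<le> n"
  shows "polynomial_of_degree_le n (\<lambda>(x :: real ^ 'n, t). c * (\<Prod>i\<in>UNIV. (x $ i) ^ \<alpha> i) * t ^ k)"
proof -
  define C where "C = (\<lambda>\<beta> l. if (\<beta>, l) = (\<alpha>, k) then c else 0)"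
  have "(\<Sum>(\<beta>, l) \<in> exponents n. C \<beta> l * (\<Prod>i\<in>UNIV. (x $ i) ^ \<beta> i) * t ^ l) =
      c * (\<Prod>i\<in>UNIV. (x $ i) ^ \<alpha> i) * t ^ k" for x :: "real ^ 'n" and t
  proof -
    have "(\<Sum>(\<beta>, l) \<in> exponents n. C \<beta> l * (\<Prod>i\<in>UNIV. (x $ i) ^ \<beta> i) * t ^ l) =
        (\<Sum>p \<in> exponents n. if p = (\<alpha>, k) then c * (\<Prod>i\<in>UNIV. (x $ i) ^ \<alpha> i) * t ^ k else 0)"
      by (rule sum.cong) (auto simp: C_def split: if_splits)
    also have "\<dots> = c * (\<Prod>i\<in>UNIV. (x $ i) ^ \<alpha> i) * t ^ k"
      using assms by (subst sum.delta[OF finite_exponents]) auto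
    finally show ?thesis .
  qed
  then show ?thesis
    unfolding polynomial_of_degree_le_def by (intro exI[of _ C]) auto
qed

lemma polynomial_add:
  assumes "polynomial_of_degree_le n p" "polynomial_of_degree_le n q"
  shows "polynomial_of_degree_le n (\<lambda>z. p z + q z)"
proof -
  obtain c where c: "\<forall>x t. p (x, t) = (\<Sum>(\<alpha>, k) \<in> exponents n. c \<alpha> k * (\<Prod>i\<in>UNIV. (x $ i) ^ \<alpha> i) * t ^ k)"
    using assms(1) unfolding polynomial_of_degree_le_def by blast
  obtain c' where c': "\<forall>x t. q (x, t) = (\<Sum>(\<alpha>, k) \<in> exponents n. c' \<alpha> k * (\<Prod>i\<in>UNIV. (x $ i) ^ \<alpha> i) * t ^ k)"
    using assms(2) unfolding polynomial_of_degree_le_def by blast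
  show ?thesis
    unfolding polynomial_of_degree_le_def
  proof (intro exI[of _ "\<lambda>\<alpha> k. c \<alpha> k + c' \<alpha> k"] allI)
    fix x t
    show "p (x, t) + q (x, t) =
        (\<Sum>(\<alpha>, k) \<in> exponents n. (c \<alpha> k + c' \<alpha> k) * (\<Prod>i\<in>UNIV. (x $ i) ^ \<alpha> i) * t ^ k)"
      unfolding c[rule_format] c'[rule_format] sum.distrib[symmetric]
      by (intro sum.cong refl) (simp add: split_beta distrib_right)
  qed
qed

lemma polynomial_zero: "polynomial_of_degree_le n (\<lambda>_. 0)"
  unfolding polynomial_of_degree_le_def by (intro exI[of _ "\<lambda>_ _. 0"]) simp

lemma polynomial_sum:
  "(\<And>i. i \<in> A \<Longrightarrow> polynomial_of_degree_le n (p i)) \<Longrightarrow> polynomial_of_degree_le n (\<lambda>z. \<Sum>i\<in>A. p i z)"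
  by (induction A rule: infinite_finite_induct) (auto intro: polynomial_zero polynomial_add)

lemma polynomial_mult_nth:
  fixes p :: "(real ^ 'n) \<times> real \<Rightarrow> real"
  assumes "polynomial_of_degree_le n p"
  shows "polynomial_of_degree_le (Suc n) (\<lambda>z. fst z $ j * p z)"
proof -
  obtain c where c: "\<forall>x t. p (x, t) = (\<Sum>(\<alpha>, k) \<in> exponents n. c \<alpha> k * (\<Prod>i\<in>UNIV. (x $ i) ^ \<alpha> i) * t ^ k)"
    using assms unfolding polynomial_of_degree_le_def by blast
  define m where "m = (\<lambda>(\<alpha>, k) (x :: real ^ 'n, t).
      c \<alpha> k * (\<Prod>i\<in>UNIV. (x $ i) ^ (\<alpha>(j := Suc (\<alpha> j))) i) * t ^ k)"
  have prod: "(\<Prod>i\<in>UNIV. (x $ i) ^ (\<alpha>(j := Suc (\<alpha> j))) i) = x $ j * (\<Prod>i\<in>UNIV. (x $ i) ^ \<alpha> i)"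
    for x :: "real ^ 'n" and \<alpha>
    by (simp add: prod.remove[of UNIV j])
  have "(\<Sum>i\<in>UNIV. (\<alpha>(j := Suc (\<alpha> j))) i) = Suc (\<Sum>i\<in>UNIV. \<alpha> i)" for \<alpha> :: "'n \<Rightarrow> nat"
    by (simp add: sum.remove[of UNIV j])
  then have "polynomial_of_degree_le (Suc n) (m a)" if "a \<in> exponents n" for a
    using that unfolding m_def by (cases a) (auto intro!: polynomial_monomial simp del: fun_upd_apply)
  then have "polynomial_of_degree_le (Suc n) (\<lambda>z. \<Sum>a\<in>exponents n. m a z)"
    by (rule polynomial_sum)
  also have "(\<lambda>z. \<Sum>a\<in>exponents n. m a z) = (\<lambda>z. fst z $ j * p z)"
  proof
    fix z :: "(real ^ 'n) \<times> real"
    obtain x t where z: "z = (x, t)" by force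
    have "m a z = x $ j * (case a of (\<alpha>, k) \<Rightarrow> c \<alpha> k * (\<Prod>i\<in>UNIV. (x $ i) ^ \<alpha> i) * t ^ k)" for a
      by (cases a) (simp only: m_def z prod prod.case mult_ac)
    then show "(\<Sum>a\<in>exponents n. m a z) = fst z $ j * p z"
      by (simp add: z c sum_distrib_left)
  qed
  finally show ?thesis .
qed

text \<open>Returns from the inductive description to coefficients. It is needed to certify the test
  functions as members of \<open>cone_polys\<close>.\<close>

lemma hpoly_polynomial:
  fixes f :: "real ^ 'n \<Rightarrow> real"
  shows "hpoly k f \<Longrightarrow> k + l \<le> n \<Longrightarrow> polynomial_of_degree_le n (\<lambda>(x, t). f x * t ^ l)"
proof (induction arbitrary: n rule: hpoly.induct)
  case (const c)
  then show ?case
    using polynomial_monomial[of "\<lambda>_. 0" l n c] by simp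
next
  case (coord k f i)
  then obtain m where "n = Suc m" "k + l \<le> m"
    by (cases n) auto
  with polynomial_mult_nth[OF coord.IH[of m], of i] show ?case
    by (simp add: split_beta mult.assoc)
next
  case (add k f g)
  with polynomial_add[OF add.IH(1)[of n] add.IH(2)[of n]] show ?case
    by (simp add: split_beta distrib_right)
qed

text \<open>As \<open>m\<close> is a strict bound, the degree is at most \<open>m - 1 + l\<close>,
  which explains \<open>Suc n\<close>. The exponent \<open>l\<close> is 0 for even and 1 for odd
  test functions.\<close>

lemma poly_lt_cone_polys:
  assumes "poly_lt m q" and "m + l \<le> Suc n"
  shows "(\<lambda>(x, t). q x * t ^ l) \<in> cone_polys n"
proof -
  obtain g where g: "\<And>k. hpoly k (g k)" "q = (\<lambda>x. \<Sum>k<m. g k x)"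
    using assms unfolding poly_lt_def by blast
  have "polynomial_of_degree_le n (\<lambda>z. \<Sum>k<m. (\<lambda>(x, t). g k x * t ^ l) z)"
    by (intro polynomial_sum hpoly_polynomial[OF g(1)]) (use assms in auto)
  also have "(\<lambda>z. \<Sum>k<m. (\<lambda>(x, t). g k x * t ^ l) z) = (\<lambda>(x, t). q x * t ^ l)"
    by (auto simp: g(2) sum_distrib_right)
  finally show ?thesis
    unfolding cone_polys_def by blast
qed

lemma hpoly_monomial_norm:
  "hpoly ((\<Sum>i\<in>UNIV. \<alpha> i) + 2 * l) (\<lambda>x :: real ^ 'n. c * ((\<Prod>i\<in>UNIV. (x $ i) ^ \<alpha> i) * ((norm x)\<^sup>2) ^ l))"
proof -
  have "hpoly (\<alpha> i) (\<lambda>x :: real ^ 'n. (x $ i) ^ \<alpha> i)" for i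
    using hpoly_power[OF hpoly_nth, of "\<alpha> i" i] by simp
  then have "hpoly ((\<Sum>i\<in>UNIV. \<alpha> i) + l * 2) (\<lambda>x :: real ^ 'n. (\<Prod>i\<in>UNIV. (x $ i) ^ \<alpha> i) * ((norm x)\<^sup>2) ^ l)"
    by (intro hpoly_mult hpoly_prod hpoly_power[OF hpoly_norm_square])
  then show ?thesis
    by (subst mult.commute[of 2]) (rule hpoly_scale)
qed

text \<open>Parity is known for the values of \<open>u\<close> on the cone, not for the representing
  polynomial, so the values at \<open>t\<close> and \<open>-t\<close> are averaged. Odd powers
  cancel, and even powers become powers of \<open>(norm x)^2\<close> of the same degree.\<close>

lemma even_cone_poly:
  fixes u :: "(real ^ 'n) \<times> real \<Rightarrow> real"
  assumes u: "u \<in> cone_polys n" and even: "even_in_t u"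
  shows "\<exists>p. poly_lt (Suc n) p \<and> (\<forall>(x, t)\<in>double_cone. u (x, t) = p x)"
proof -
  obtain c where c: "(x, t) \<in> double_cone \<Longrightarrow>
      u (x, t) = (\<Sum>(\<alpha>, k) \<in> exponents n. c \<alpha> k * (\<Prod>i\<in>UNIV. (x $ i) ^ \<alpha> i) * t ^ k)" for x t
    using u unfolding cone_polys_def polynomial_of_degree_le_def by auto
  define m where "m = (\<lambda>(\<alpha>, k) x. if even k
      then c \<alpha> k * ((\<Prod>i\<in>UNIV. (x $ i) ^ \<alpha> i) * ((norm (x :: real ^ 'n))\<^sup>2) ^ (k div 2)) else 0)"
  have "poly_lt (Suc n) (m a)" if "a \<in> exponents n" for a
  proof -
    obtain \<alpha> k where a: "a = (\<alpha>, k)" by force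
    show ?thesis
    proof (cases "even k")
      case True
      then show ?thesis
        using that hpoly_poly_lt[OF hpoly_monomial_norm[of \<alpha> "k div 2" "c \<alpha> k"], of "Suc n"]
        by (simp add: a m_def)
    qed (simp add: a m_def poly_lt_zero)
  qed
  then have "poly_lt (Suc n) (\<lambda>x. \<Sum>a\<in>exponents n. m a x)"
    by (rule poly_lt_sum)
  moreover have "u (x, t) = (\<Sum>a\<in>exponents n. m a x)" if xt: "(x, t) \<in> double_cone" for x t
  proof -
    have xt': "(x, - t) \<in> double_cone" and norm: "(norm x)\<^sup>2 = t\<^sup>2"
      using xt by (auto simp: double_cone_def)
    have "u (x, t) = (u (x, t) + u (x, - t)) / 2"
      using even xt by (auto simp: even_in_t_def)
    also have "\<dots> = (\<Sum>(\<alpha>, k) \<in> exponents n. c \<alpha> k * (\<Prod>i\<in>UNIV. (x $ i) ^ \<alpha> i) * ((t ^ k + (- t) ^ k) / 2))"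
      unfolding c[OF xt] c[OF xt'] sum.distrib[symmetric] sum_divide_distrib
      by (intro sum.cong) (auto simp: algebra_simps add_divide_distrib)
    also have "\<dots> = (\<Sum>a\<in>exponents n. m a x)"
      by (intro sum.cong) (auto simp: m_def norm power_mult[symmetric] uminus_power_if elim!: evenE)
    finally show ?thesis .
  qed
  ultimately show ?thesis
    by (intro exI[of _ "\<lambda>x. \<Sum>a\<in>exponents n. m a x"]) auto
qed

lemma odd_cone_poly:
  fixes u :: "(real ^ 'n) \<times> real \<Rightarrow> real"
  assumes u: "u \<in> cone_polys n" and odd: "odd_in_t u"
  shows "\<exists>p. poly_lt n p \<and> (\<forall>(x, t)\<in>double_cone. u (x, t) = p x * t)"
proof -
  obtain c where c: "(x, t) \<in> double_cone \<Longrightarrow>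
      u (x, t) = (\<Sum>(\<alpha>, k) \<in> exponents n. c \<alpha> k * (\<Prod>i\<in>UNIV. (x $ i) ^ \<alpha> i) * t ^ k)" for x t
    using u unfolding cone_polys_def polynomial_of_degree_le_def by auto
  define m where "m = (\<lambda>(\<alpha>, k) x. if odd k
      then c \<alpha> k * ((\<Prod>i\<in>UNIV. (x $ i) ^ \<alpha> i) * ((norm (x :: real ^ 'n))\<^sup>2) ^ (k div 2)) else 0)"
  have "poly_lt n (m a)" if "a \<in> exponents n" for a
  proof -
    obtain \<alpha> k where a: "a = (\<alpha>, k)" by force
    show ?thesis
    proof (cases "odd k")
      case True
      \<comment> \<open>Splitting off one \<open>t\<close> lowers the degree by one; this is the
        source of \<open>poly_lt n\<close> in place of \<open>poly_lt (Suc n)\<close>.\<close>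
      then have "2 * (k div 2) < k"
        by presburger
      then have "(\<Sum>i\<in>UNIV. \<alpha> i) + 2 * (k div 2) < n"
        using that by (simp add: a)
      then show ?thesis
        using hpoly_poly_lt[OF hpoly_monomial_norm[of \<alpha> "k div 2" "c \<alpha> k"], of n] True
        by (simp add: a m_def)
    qed (simp add: a m_def poly_lt_zero)
  qed
  then have "poly_lt n (\<lambda>x. \<Sum>a\<in>exponents n. m a x)"
    by (rule poly_lt_sum)
  moreover have "u (x, t) = (\<Sum>a\<in>exponents n. m a x) * t" if xt: "(x, t) \<in> double_cone" for x t
  proof -
    have xt': "(x, - t) \<in> double_cone" and norm: "(norm x)\<^sup>2 = t\<^sup>2"
      using xt by (auto simp: double_cone_def)
    have "u (x, t) = (u (x, t) - u (x, - t)) / 2"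
      using odd xt by (auto simp: odd_in_t_def)
    also have "\<dots> = (\<Sum>(\<alpha>, k) \<in> exponents n. c \<alpha> k * (\<Prod>i\<in>UNIV. (x $ i) ^ \<alpha> i) * ((t ^ k - (- t) ^ k) / 2))"
      unfolding c[OF xt] c[OF xt'] sum_subtractf[symmetric] sum_divide_distrib
      by (intro sum.cong) (auto simp: algebra_simps diff_divide_distrib)
    also have "\<dots> = (\<Sum>a\<in>exponents n. m a x * t)"
      by (intro sum.cong) (auto simp: m_def norm power_mult[symmetric] uminus_power_if elim!: oddE)
    finally show ?thesis
      by (simp add: sum_distrib_right)
  qed
  ultimately show ?thesis
    by (intro exI[of _ "\<lambda>x. \<Sum>a\<in>exponents n. m a x"]) auto
qed

section \<open>The cone inner products as weighted integrals over the ball\<close>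

lemma cone_inner_even:
  fixes u q :: "(real ^ 'n) \<times> real \<Rightarrow> real"
  assumes "\<And>x t. (x, t) \<in> double_cone \<Longrightarrow> u (x, t) = p x"
    and "\<And>x t. (x, t) \<in> double_cone \<Longrightarrow> q (x, t) = r x"
  shows "cone_inner (\<lambda>t. (1 - t\<^sup>2) powr (\<gamma> - 1 / 2)) u q = ball_integral \<gamma> (\<lambda>x. p x * r x)"
proof -
  have "(LINT \<xi>|surface_measure. u (\<bar>t\<bar> *\<^sub>R \<xi>, t) * q (\<bar>t\<bar> *\<^sub>R \<xi>, t) * (1 - t\<^sup>2) powr (\<gamma> - 1 / 2)) =
      (1 - t\<^sup>2) powr (\<gamma> - 1 / 2) * sph (\<lambda>\<xi>. p (\<bar>t\<bar> *\<^sub>R \<xi>) * r (\<bar>t\<bar> *\<^sub>R \<xi>))" if "t \<in> {-1..1}" for t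
    unfolding sph_def[symmetric] sph_scale[symmetric]
    using that by (intro sph_cong) (auto simp: double_cone_def assms)
  then show ?thesis
    unfolding cone_inner_def cone_integral_def ball_integral_def
    by (intro set_lebesgue_integral_cong) auto
qed

text \<open>For nonzero \<open>t\<close> the two factors \<open>t\<close> cancel
  \<open>\<bar>t\<bar> powr (-2)\<close> exactly; at \<open>t = 0\<close> both sides vanish through
  \<open>\<bar>t\<bar> ^ (d - 1)\<close>, as \<open>d\<close> is at least 2.\<close>

lemma cone_inner_odd:
  fixes u q :: "(real ^ 'n) \<times> real \<Rightarrow> real"
  assumes d: "CARD('n) \<ge> 2"
    and "\<And>x t. (x, t) \<in> double_cone \<Longrightarrow> u (x, t) = p x * t"
    and "\<And>x t. (x, t) \<in> double_cone \<Longrightarrow> q (x, t) = r x * t"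
  shows "cone_inner (\<lambda>t. \<bar>t\<bar> powr (-2) * (1 - t\<^sup>2) powr (\<gamma> - 1 / 2)) u q = ball_integral \<gamma> (\<lambda>x. p x * r x)"
proof -
  have "\<bar>t\<bar> ^ (CARD('n) - 1) * (LINT \<xi>|surface_measure. u (\<bar>t\<bar> *\<^sub>R \<xi>, t) * q (\<bar>t\<bar> *\<^sub>R \<xi>, t) *
        (\<bar>t\<bar> powr (-2) * (1 - t\<^sup>2) powr (\<gamma> - 1 / 2))) =
      \<bar>t\<bar> ^ (CARD('n) - 1) * ((1 - t\<^sup>2) powr (\<gamma> - 1 / 2) * sph (\<lambda>\<xi>. p (\<bar>t\<bar> *\<^sub>R \<xi>) * r (\<bar>t\<bar> *\<^sub>R \<xi>)))"
    if t: "t \<in> {-1..1}" for t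
  proof (cases "t = 0")
    case False
    then have weight: "t * t * \<bar>t\<bar> powr (-2) = 1"
      by (simp add: powr_minus powr_numeral power2_eq_square field_simps)
    have "u (\<bar>t\<bar> *\<^sub>R \<xi>, t) * q (\<bar>t\<bar> *\<^sub>R \<xi>, t) * (\<bar>t\<bar> powr (-2) * (1 - t\<^sup>2) powr (\<gamma> - 1 / 2)) =
        (1 - t\<^sup>2) powr (\<gamma> - 1 / 2) * (p (\<bar>t\<bar> *\<^sub>R \<xi>) * r (\<bar>t\<bar> *\<^sub>R \<xi>))" if "norm \<xi> = 1" for \<xi>
    proof -
      have "u (\<bar>t\<bar> *\<^sub>R \<xi>, t) * q (\<bar>t\<bar> *\<^sub>R \<xi>, t) * (\<bar>t\<bar> powr (-2) * (1 - t\<^sup>2) powr (\<gamma> - 1 / 2)) =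
          (t * t * \<bar>t\<bar> powr (-2)) * ((1 - t\<^sup>2) powr (\<gamma> - 1 / 2) * (p (\<bar>t\<bar> *\<^sub>R \<xi>) * r (\<bar>t\<bar> *\<^sub>R \<xi>)))"
        using that t by (simp add: double_cone_def assms mult_ac)
      then show ?thesis
        by (simp only: weight mult_1)
    qed
    then have "sph (\<lambda>\<xi>. u (\<bar>t\<bar> *\<^sub>R \<xi>, t) * q (\<bar>t\<bar> *\<^sub>R \<xi>, t) * (\<bar>t\<bar> powr (-2) * (1 - t\<^sup>2) powr (\<gamma> - 1 / 2))) =
        sph (\<lambda>\<xi>. (1 - t\<^sup>2) powr (\<gamma> - 1 / 2) * (p (\<bar>t\<bar> *\<^sub>R \<xi>) * r (\<bar>t\<bar> *\<^sub>R \<xi>)))"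
      by (rule sph_cong)
    then show ?thesis
      unfolding sph_def[symmetric] sph_scale by (rule arg_cong)
  qed (use d in simp)
  then show ?thesis
    unfolding cone_inner_def cone_integral_def ball_integral_def
    by (intro set_lebesgue_integral_cong) auto
qed

subsection \<open>Derivatives in cone coordinates\<close>

text \<open>The form \<open>k * \<bar>t\<bar> ^ k / t\<close> serves both signs of \<open>t\<close>
  and \<open>k = 0\<close> alike, with no truncated exponent.\<close>

lemma DERIV_abs_power:
  assumes "t \<noteq> 0"
  shows "((\<lambda>s::real. \<bar>s\<bar> ^ k) has_real_derivative real k * \<bar>t\<bar> ^ k / t) (at t)"
proof (cases "t > 0")
  case True
  have "((\<lambda>s. s ^ k) has_real_derivative real k * \<bar>t\<bar> ^ k / t) (at t)"
    using DERIV_pow[of k t] by (rule DERIV_cong) (use True in \<open>cases k; simp\<close>)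
  then show ?thesis
    by (rule has_field_derivative_transform_within_open[where S = "{0<..}"]) (use True in auto)
next
  case False
  have "((\<lambda>s. (- s) ^ k) has_real_derivative real k * (- t) ^ (k - Suc 0) * - 1) (at t)"
    using DERIV_chain2[OF DERIV_pow DERIV_minus[OF DERIV_ident]] by simp
  then have "((\<lambda>s. (- s) ^ k) has_real_derivative real k * \<bar>t\<bar> ^ k / t) (at t)"
    by (rule DERIV_cong) (use False assms in \<open>cases k; simp\<close>)
  then show ?thesis
    by (rule has_field_derivative_transform_within_open[where S = "{..<0}"]) (use False assms in auto)
qed

text \<open>A two-sided derivative of a formula restricts to the one-sided derivative at the rims.
  Agreement is asked away from 0 only, because the formula for the first derivative, needed for the
  second, holds only there; the radius \<open>\<bar>t\<bar>\<close> avoids 0.\<close>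

lemma d_dt_eqI:
  assumes t: "t \<noteq> 0" "t \<in> {-1..1}"
    and eq: "\<And>s. s \<noteq> 0 \<Longrightarrow> s \<in> {-1..1} \<Longrightarrow> g \<xi> s = f s"
    and f: "(f has_real_derivative D) (at t)"
  shows "d_dt g \<xi> t = D"
proof -
  have "(f has_vector_derivative D) (at t within {-1..1})"
    using f by (simp add: has_real_derivative_iff_has_vector_derivative has_vector_derivative_at_within)
  then have "(g \<xi> has_vector_derivative D) (at t within {-1..1})"
  proof (rule has_vector_derivative_transform_within[where d = "\<bar>t\<bar>"])
    show "f s = g \<xi> s" if "s \<in> {-1..1}" "dist s t < \<bar>t\<bar>" for s
      using eq[of s] that by (auto simp: dist_real_def)
  qed (use t in auto)
  then show ?thesis
    unfolding d_dt_def using t by (intro vector_derivative_within_closed_interval) auto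
qed

lemma deriv2_eqI:
  fixes f :: "real \<Rightarrow> real"
  assumes eq: "\<And>s. \<bar>s\<bar> < 1 \<Longrightarrow> f s = F s"
    and F: "\<And>s. \<bar>s\<bar> < 1 \<Longrightarrow> (F has_real_derivative F' s) (at s)"
    and F': "(F' has_real_derivative D) (at 0)"
  shows "(deriv ^^ 2) f 0 = D"
proof -
  have d: "deriv f s = F' s" if "\<bar>s\<bar> < 1" for s
  proof (rule DERIV_imp_deriv)
    show "(f has_real_derivative F' s) (at s)"
      by (rule has_field_derivative_transform_within_open[OF F[OF that], of "{-1<..<1}"])
        (use that eq in \<open>auto simp: abs_less_iff\<close>)
  qed
  have "(deriv f has_real_derivative D) (at 0)"
    by (rule has_field_derivative_transform_within_open[OF F', of "{-1<..<1}"])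
      (use d in \<open>auto simp: abs_less_iff\<close>)
  then show ?thesis
    by (simp add: numeral_2_eq_2 DERIV_imp_deriv)
qed

section \<open>The Laplace-Beltrami operator on restrictions of homogeneous polynomials\<close>

lemma sum_Basis_vec: "(\<Sum>b\<in>Basis. f b) = (\<Sum>i\<in>UNIV. f (axis i 1 :: real ^ 'n))"
proof -
  have "(Basis :: (real ^ 'n) set) = range (\<lambda>i. axis i 1)"
    by (auto simp: Basis_vec_def)
  then have "(\<Sum>b\<in>Basis. f b) = sum f (range (\<lambda>i. axis i 1))"
    by (rule arg_cong)
  moreover have "inj (\<lambda>i. axis i 1 :: real ^ 'n)"
    by (auto simp: inj_on_def axis_eq_axis)
  ultimately show ?thesis
    by (simp only: sum.reindex o_def)
qed

lemma norm_line_square: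
  fixes \<xi> :: "real ^ 'n"
  assumes "norm \<xi> = 1"
  shows "(norm (\<xi> + s *\<^sub>R axis i 1))\<^sup>2 = 1 + 2 * s * \<xi> $ i + s\<^sup>2"
proof -
  have "(norm (\<xi> + s *\<^sub>R axis i 1))\<^sup>2 = (norm \<xi>)\<^sup>2 + 2 * (s * \<xi> $ i) + s\<^sup>2"
    unfolding power2_norm_eq_inner
    by (simp add: inner_add_left inner_add_right inner_axis inner_axis' power2_eq_square algebra_simps)
  then show ?thesis
    using assms by simp
qed

lemma norm_line_pos:
  fixes \<xi> :: "real ^ 'n"
  assumes "norm \<xi> = 1" "\<bar>s\<bar> < 1"
  shows "\<xi> + s *\<^sub>R axis i 1 \<noteq> 0"
proof
  assume "\<xi> + s *\<^sub>R axis i 1 = 0"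
  then have "\<xi> = - (s *\<^sub>R axis i 1)"
    by (simp add: eq_neg_iff_add_eq_0)
  then have "norm \<xi> = \<bar>s\<bar>"
    by simp
  with assms show False by simp
qed

text \<open>The first derivative of \<open>h (sgn y)\<close> along
  \<open>y = \<xi> + s *\<^sub>R axis i 1\<close>, where homogeneity gives \<open>h y\<close> times
  \<open>N\<close> to the power \<open>- k / 2\<close> with \<open>N\<close> the squared norm of
  \<open>y\<close>.\<close>

definition sgn_line_deriv :: "nat \<Rightarrow> (real ^ 'n \<Rightarrow> real) \<Rightarrow> real ^ 'n \<Rightarrow> 'n \<Rightarrow> real \<Rightarrow> real" where
  "sgn_line_deriv k h \<xi> i s = (let y = \<xi> + s *\<^sub>R axis i 1; N = 1 + 2 * s * \<xi> $ i + s\<^sup>2; m = - (real k / 2) in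
     partial i h y * N powr m + h y * (m * N powr (m - 1) * (2 * \<xi> $ i + 2 * s)))"

lemma DERIV_norm_line_powr:
  fixes c s m :: real
  assumes "1 + 2 * s * c + s\<^sup>2 > 0"
  shows "((\<lambda>s. (1 + 2 * s * c + s\<^sup>2) powr m) has_real_derivative
    m * (1 + 2 * s * c + s\<^sup>2) powr (m - 1) * (2 * c + 2 * s)) (at s)"
  using assms by (auto intro!: derivative_eq_intros simp: algebra_simps)

lemma DERIV_sgn_line:
  fixes h :: "real ^ 'n \<Rightarrow> real"
  assumes h: "hpoly k h" and \<xi>: "norm \<xi> = 1" and s: "\<bar>s\<bar> < 1"
  shows "((\<lambda>s. h (\<xi> + s *\<^sub>R axis i 1) * (1 + 2 * s * \<xi> $ i + s\<^sup>2) powr - (real k / 2))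
    has_real_derivative sgn_line_deriv k h \<xi> i s) (at s)"
proof -
  have "1 + 2 * s * \<xi> $ i + s\<^sup>2 > 0"
    using norm_line_square[OF \<xi>, of s i] norm_line_pos[OF \<xi> s, of i]
    by (metis zero_less_norm_iff zero_less_power)
  from DERIV_mult[OF has_field_derivative_line[OF hpoly_differentiable[OF h]] DERIV_norm_line_powr[OF this]]
  show ?thesis
    by (rule DERIV_cong) (simp add: sgn_line_deriv_def Let_def mult.commute)
qed

text \<open>At \<open>s = 0\<close> the squared norm is 1 with derivatives
  \<open>2 * \<xi> $ i\<close> and 2, so with \<open>m = - k / 2\<close> the second derivative of
  its power is \<open>4 m (m - 1) (\<xi> $ i)^2 + 2 m\<close>.\<close>

lemma DERIV2_sgn_line:
  fixes h :: "real ^ 'n \<Rightarrow> real"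
  assumes h: "hpoly k h" and \<xi>: "norm \<xi> = 1"
  shows "(sgn_line_deriv k h \<xi> i has_real_derivative
    partial i (partial i h) \<xi> - 2 * real k * (\<xi> $ i * partial i h \<xi>) +
      real k * (real k + 2) * (\<xi> $ i)\<^sup>2 * h \<xi> - real k * h \<xi>) (at 0)"
proof -
  have line: "((\<lambda>s. h (\<xi> + s *\<^sub>R axis i 1)) has_real_derivative partial i h \<xi>) (at 0)"
    "((\<lambda>s. partial i h (\<xi> + s *\<^sub>R axis i 1)) has_real_derivative partial i (partial i h) \<xi>) (at 0)"
    using has_field_derivative_line[OF hpoly_differentiable[OF h, of "\<xi> + 0 *\<^sub>R axis i 1"]]
      has_field_derivative_line[OF hpoly_differentiable[OF hpoly_partial[OF h, of i], of "\<xi> + 0 *\<^sub>R axis i 1"]]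
    by simp_all
  have N: "((\<lambda>s. (1 + 2 * s * \<xi> $ i + s\<^sup>2) powr m) has_real_derivative m * (2 * \<xi> $ i)) (at 0)" for m
    using DERIV_norm_line_powr[of 0 "\<xi> $ i" m] by simp
  have "((\<lambda>s. 2 * \<xi> $ i + 2 * s) has_real_derivative 2) (at 0)"
    by (auto intro!: derivative_eq_intros)
  note DERIV_add[OF DERIV_mult[OF line(2) N] DERIV_mult[OF line(1) DERIV_mult[OF DERIV_cmult[OF N] this]],
    of "- (real k / 2)" "- (real k / 2)" "- (real k / 2) - 1"]
  then show ?thesis
    unfolding sgn_line_deriv_def[abs_def] Let_def
    by (rule DERIV_cong) (simp add: field_simps power2_eq_square)
qed

lemma hpoly_sgn_line:
  fixes h :: "real ^ 'n \<Rightarrow> real"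
  assumes h: "hpoly k h" and \<xi>: "norm \<xi> = 1" and s: "\<bar>s\<bar> < 1"
  shows "h (sgn (\<xi> + s *\<^sub>R axis i 1)) =
    h (\<xi> + s *\<^sub>R axis i 1) * (1 + 2 * s * \<xi> $ i + s\<^sup>2) powr - (real k / 2)"
proof -
  let ?y = "\<xi> + s *\<^sub>R axis i 1"
  have pos: "norm ?y > 0"
    using norm_line_pos[OF \<xi> s] by simp
  have "(1 + 2 * s * \<xi> $ i + s\<^sup>2) powr - (real k / 2) = (norm ?y powr 2) powr - (real k / 2)"
    using pos by (simp add: norm_line_square[OF \<xi>, symmetric] powr_numeral)
  also have "\<dots> = norm ?y powr - real k"
    by (simp only: powr_powr) simp
  also have "\<dots> = inverse (norm ?y) ^ k"
    using pos by (simp add: powr_minus powr_realpow power_inverse)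
  finally show ?thesis
    by (simp add: sgn_div_norm hpoly_scaleR[OF h])
qed

text \<open>Summing the second derivatives over the coordinates, Euler's identity and
  \<open>norm \<xi> = 1\<close> collect \<open>-2 k^2 + k (k + 2) - d k\<close>, which is
  \<open>- k (k + d - 2)\<close>. The scalars \<open>c k\<close> take the radial factors at a fixed
  \<open>t\<close>.\<close>

lemma laplace_beltrami_sum:
  fixes h :: "nat \<Rightarrow> real ^ 'n \<Rightarrow> real"
  assumes h: "\<And>k. hpoly k (h k)" and \<xi>: "norm \<xi> = 1"
    and f: "\<And>\<eta>. norm \<eta> = 1 \<Longrightarrow> f \<eta> = (\<Sum>k<n. c k * h k \<eta>)"
  shows "laplace_beltrami f \<xi> =
    (\<Sum>k<n. c k * (lap (h k) \<xi> - real k * (real k + real CARD('n) - 2) * h k \<xi>))"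
proof -
  define D where "D = (\<lambda>i k. partial i (partial i (h k)) \<xi> - 2 * real k * (\<xi> $ i * partial i (h k) \<xi>) +
      real k * (real k + 2) * (\<xi> $ i)\<^sup>2 * h k \<xi> - real k * h k \<xi>)"
  have "(deriv ^^ 2) (\<lambda>s. f (sgn (\<xi> + s *\<^sub>R axis i 1))) 0 = (\<Sum>k<n. c k * D i k)" for i
  proof (rule deriv2_eqI)
    show "f (sgn (\<xi> + s *\<^sub>R axis i 1)) =
        (\<Sum>k<n. c k * (h k (\<xi> + s *\<^sub>R axis i 1) * (1 + 2 * s * \<xi> $ i + s\<^sup>2) powr - (real k / 2)))"
      if "\<bar>s\<bar> < 1" for s
      using norm_line_pos[OF \<xi> that, of i] by (simp add: f norm_sgn hpoly_sgn_line[OF h \<xi> that])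
    show "((\<lambda>s. \<Sum>k<n. c k * (h k (\<xi> + s *\<^sub>R axis i 1) * (1 + 2 * s * \<xi> $ i + s\<^sup>2) powr - (real k / 2)))
        has_real_derivative (\<Sum>k<n. c k * sgn_line_deriv k (h k) \<xi> i s)) (at s)" if "\<bar>s\<bar> < 1" for s
      by (intro DERIV_sum DERIV_cmult DERIV_sgn_line[OF h \<xi> that])
    show "((\<lambda>s. \<Sum>k<n. c k * sgn_line_deriv k (h k) \<xi> i s) has_real_derivative (\<Sum>k<n. c k * D i k)) (at 0)"
      unfolding D_def by (intro DERIV_sum DERIV_cmult DERIV2_sgn_line[OF h \<xi>])
  qed
  then have "laplace_beltrami f \<xi> = (\<Sum>i\<in>UNIV. \<Sum>k<n. c k * D i k)"
    by (simp add: laplace_beltrami_def laplacian_def sum_Basis_vec)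
  also have "\<dots> = (\<Sum>k<n. c k * (\<Sum>i\<in>UNIV. D i k))"
    by (subst sum.swap) (simp add: sum_distrib_left)
  also have "\<dots> = (\<Sum>k<n. c k * (lap (h k) \<xi> - real k * (real k + real CARD('n) - 2) * h k \<xi>))"
  proof (intro sum.cong refl arg_cong[where f = "(*) _"])
    fix k
    have "(\<Sum>i\<in>UNIV. (\<xi> $ i)\<^sup>2) = 1"
      using \<xi> by (simp flip: norm_square_sum)
    then have "(\<Sum>i\<in>UNIV. D i k) = lap (h k) \<xi> - 2 * real k * (real k * h k \<xi>) +
        real k * (real k + 2) * 1 * h k \<xi> - real CARD('n) * (real k * h k \<xi>)"
      unfolding D_def sum.distrib sum_subtractf sum_distrib_left[symmetric] sum_distrib_right[symmetric]
        euler_identity[OF h] lap_def by simp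
    then show "(\<Sum>i\<in>UNIV. D i k) = lap (h k) \<xi> - real k * (real k + real CARD('n) - 2) * h k \<xi>"
      by (simp add: algebra_simps)
  qed
  finally show ?thesis .
qed

lemma hpoly_lap_scaleR:
  assumes h: "hpoly k h" and "r \<noteq> 0"
  shows "lap h (r *\<^sub>R x) = r ^ k / r\<^sup>2 * lap h x"
proof (cases "k < 2")
  case False
  then show ?thesis
    using assms by (simp add: hpoly_scaleR[OF hpoly_lap[OF h]] power_diff)
qed (simp add: lap_eq_0[OF h])

subsection \<open>The differential equations\<close>

lemma even_cone_equation:
  fixes u :: "(real ^ 'n) \<times> real \<Rightarrow> real"
  defines "g \<equiv> cone_coords u" and "d \<equiv> real CARD('n)"
  assumes card: "CARD('n) \<ge> 2" and \<gamma>: "\<gamma> > - 1 / 2"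
    and u: "u \<in> V_even n (\<lambda>t. (1 - t\<^sup>2) powr (\<gamma> - 1 / 2))"
    and \<xi>: "norm \<xi> = 1" and t: "t \<noteq> 0" "-1 \<le> t" "t \<le> 1"
  shows "(1 - t\<^sup>2) * d_dt (d_dt g) \<xi> t - (2 * \<gamma> + d) * t * d_dt g \<xi> t + (d - 1) / t * d_dt g \<xi> t
    + 1 / t\<^sup>2 * laplace_beltrami (\<lambda>\<eta>. g \<eta> t) \<xi> = - real n * (real n + 2 * \<gamma> + d - 1) * g \<xi> t"
proof -
  have "u \<in> cone_polys n" "even_in_t u"
    and orth: "\<And>m q. m < n \<Longrightarrow> q \<in> cone_polys m \<Longrightarrow> even_in_t q \<Longrightarrow>
      cone_inner (\<lambda>t. (1 - t\<^sup>2) powr (\<gamma> - 1 / 2)) u q = 0"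
    using u by (auto simp: V_even_def)
  then obtain p where "poly_lt (Suc n) p" "\<forall>(x, t)\<in>double_cone. u (x, t) = p x"
    using even_cone_poly by blast
  then obtain h where h: "\<And>k. hpoly k (h k)"
    and u_eq: "\<And>x t. (x, t) \<in> double_cone \<Longrightarrow> u (x, t) = (\<Sum>k<Suc n. h k x)"
    unfolding poly_lt_def by blast
  have "ball_integral \<gamma> (\<lambda>x. (\<Sum>k<Suc n. h k x) * q x) = 0" if q: "poly_lt n q" for q
  proof (cases n)
    case 0
    \<comment> \<open>For \<open>n = 0\<close> there is no orthogonality hypothesis to use, but the
      strict bound leaves only the zero test function.\<close>
    then have "q = (\<lambda>_. 0)"
      using q by (auto simp: poly_lt_def)
    then show ?thesis
      by (simp add: ball_integral_zero)
  next
    case (Suc m)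
    have "(\<lambda>(x, t). q x * t ^ 0) \<in> cone_polys m"
      using poly_lt_cone_polys[OF q, of 0 m] Suc by simp
    then have "cone_inner (\<lambda>t. (1 - t\<^sup>2) powr (\<gamma> - 1 / 2)) u (\<lambda>(x, t). q x) = 0"
      using Suc by (intro orth[of m]) (auto simp: even_in_t_def)
    then show ?thesis
      using cone_inner_even[of u "\<lambda>x. \<Sum>k<Suc n. h k x" "\<lambda>(x, t). q x" q \<gamma>] u_eq by simp
  qed
  from ball_operator_eigenfunction[OF \<gamma> card h this, of "\<bar>t\<bar> *\<^sub>R \<xi>"]
  have "(\<Sum>k<Suc n. lap (h k) (\<bar>t\<bar> *\<^sub>R \<xi>) + (eigval \<gamma> d n - eigval \<gamma> d k) * h k (\<bar>t\<bar> *\<^sub>R \<xi>)) = 0"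
    using \<xi> t by (simp add: d_def)
  then have zero: "(\<Sum>k<Suc n. \<bar>t\<bar> ^ k / t\<^sup>2 * lap (h k) \<xi> + (eigval \<gamma> d n - eigval \<gamma> d k) * (h k \<xi> * \<bar>t\<bar> ^ k)) = 0"
    using t by (simp only: hpoly_lap_scaleR[OF h] hpoly_scaleR[OF h] abs_eq_0 not_False_eq_True power2_abs mult.commute[of "h _ \<xi>"])
  have g: "g \<eta> s = (\<Sum>k<Suc n. h k \<eta> * \<bar>s\<bar> ^ k)" if "norm \<eta> = 1" "s \<in> {-1..1}" for \<eta> s
    using that unfolding g_def cone_coords_def
    by (subst u_eq) (auto simp: double_cone_def hpoly_scaleR[OF h] mult.commute simp del: sum.lessThan_Suc)
  have dt: "d_dt g \<xi> s = (\<Sum>k<Suc n. h k \<xi> * (real k * \<bar>s\<bar> ^ k / s))" if "s \<noteq> 0" "s \<in> {-1..1}" for s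
  proof (rule d_dt_eqI[OF that])
    show "g \<xi> r = (\<Sum>k<Suc n. h k \<xi> * \<bar>r\<bar> ^ k)" if "r \<in> {-1..1}" for r
      by (rule g[OF \<xi> that])
    show "((\<lambda>r. \<Sum>k<Suc n. h k \<xi> * \<bar>r\<bar> ^ k) has_real_derivative
        (\<Sum>k<Suc n. h k \<xi> * (real k * \<bar>s\<bar> ^ k / s))) (at s)"
      by (intro DERIV_sum DERIV_cmult DERIV_abs_power that)
  qed
  have t_mem: "t \<in> {-1..1}"
    using t by simp
  have dtt: "d_dt (d_dt g) \<xi> t = (\<Sum>k<Suc n. h k \<xi> * (real k * (real k - 1) * \<bar>t\<bar> ^ k / t\<^sup>2))"
  proof (rule d_dt_eqI[where f = "\<lambda>s. \<Sum>k<Suc n. h k \<xi> * (real k * \<bar>s\<bar> ^ k / s)"])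
    have "((\<lambda>s. real k * \<bar>s\<bar> ^ k / s) has_real_derivative real k * (real k - 1) * \<bar>t\<bar> ^ k / t\<^sup>2) (at t)" for k
      by (rule DERIV_cong[OF DERIV_divide[OF DERIV_cmult[OF DERIV_abs_power[OF t(1)]] DERIV_ident t(1)]])
        (use t(1) in \<open>simp add: field_simps power2_eq_square\<close>)
    then show "((\<lambda>s. \<Sum>k<Suc n. h k \<xi> * (real k * \<bar>s\<bar> ^ k / s)) has_real_derivative
        (\<Sum>k<Suc n. h k \<xi> * (real k * (real k - 1) * \<bar>t\<bar> ^ k / t\<^sup>2))) (at t)"
      by (intro DERIV_sum DERIV_cmult)
  qed (use t dt in \<open>auto simp del: sum.lessThan_Suc\<close>)
  have lb: "laplace_beltrami (\<lambda>\<eta>. g \<eta> t) \<xi> =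
      (\<Sum>k<Suc n. \<bar>t\<bar> ^ k * (lap (h k) \<xi> - real k * (real k + d - 2) * h k \<xi>))"
    unfolding d_def
    by (rule laplace_beltrami_sum[OF h \<xi>]) (use t in \<open>simp add: g mult.commute del: sum.lessThan_Suc\<close>)
  \<comment> \<open>The angular term \<open>- k (k + d - 2)\<close> cancels the
    \<open>1 / t^2\<close> contributions \<open>k (k - 1) + (d - 1) k\<close> of the radial
    derivatives; what remains besides the Laplacian is
    \<open>- k (k - 1) - (2 \<gamma> + d) k\<close>, that is
    \<open>- eigval \<gamma> d k\<close>.\<close>
  have summand: "(1 - t\<^sup>2) * (h k \<xi> * (real k * (real k - 1) * P / t\<^sup>2))
      - (2 * \<gamma> + d) * t * (h k \<xi> * (real k * P / t)) + (d - 1) / t * (h k \<xi> * (real k * P / t))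
      + 1 / t\<^sup>2 * (P * (lap (h k) \<xi> - real k * (real k + d - 2) * h k \<xi>)) =
    (P / t\<^sup>2 * lap (h k) \<xi> + (eigval \<gamma> d n - eigval \<gamma> d k) * (h k \<xi> * P)) - eigval \<gamma> d n * (h k \<xi> * P)" for k P
    using t(1) by (simp add: eigval_def field_simps power2_eq_square)
  have "(1 - t\<^sup>2) * d_dt (d_dt g) \<xi> t - (2 * \<gamma> + d) * t * d_dt g \<xi> t + (d - 1) / t * d_dt g \<xi> t
      + 1 / t\<^sup>2 * laplace_beltrami (\<lambda>\<eta>. g \<eta> t) \<xi> = - eigval \<gamma> d n * g \<xi> t"
    using zero
    by (simp only: dtt dt[OF t(1) t_mem] lb g[OF \<xi> t_mem] sum_distrib_left sum.distrib[symmetric] sum_subtractf[symmetric] summand)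
      (simp only: sum_subtractf sum_distrib_left[symmetric] diff_0 minus_mult_left)
  then show ?thesis
    by (simp add: eigval_def)
qed

lemma odd_cone_equation:
  fixes u :: "(real ^ 'n) \<times> real \<Rightarrow> real"
  defines "g \<equiv> cone_coords u" and "d \<equiv> real CARD('n)"
  assumes card: "CARD('n) \<ge> 2" and \<gamma>: "\<gamma> > - 1 / 2"
    and u: "u \<in> V_odd n (\<lambda>t. \<bar>t\<bar> powr (-2) * (1 - t\<^sup>2) powr (\<gamma> - 1 / 2))"
    and \<xi>: "norm \<xi> = 1" and t: "t \<noteq> 0" "-1 \<le> t" "t \<le> 1"
  shows "(1 - t\<^sup>2) * d_dt (d_dt g) \<xi> t - (2 * \<gamma> + d - 2) * t * d_dt g \<xi> t
    + (d - 3) / t * (d_dt g \<xi> t - 1 / t * g \<xi> t)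
    + 1 / t\<^sup>2 * laplace_beltrami (\<lambda>\<eta>. g \<eta> t) \<xi> = - real n * (real n + 2 * \<gamma> + d - 3) * g \<xi> t"
proof -
  have "u \<in> cone_polys n" "odd_in_t u"
    and orth: "\<And>m q. m < n \<Longrightarrow> q \<in> cone_polys m \<Longrightarrow> odd_in_t q \<Longrightarrow>
      cone_inner (\<lambda>t. \<bar>t\<bar> powr (-2) * (1 - t\<^sup>2) powr (\<gamma> - 1 / 2)) u q = 0"
    using u by (auto simp: V_odd_def)
  then obtain p where "poly_lt n p" "\<forall>(x, t)\<in>double_cone. u (x, t) = p x * t"
    using odd_cone_poly by blast
  then obtain h where h: "\<And>k. hpoly k (h k)"
    and u_eq: "\<And>x t. (x, t) \<in> double_cone \<Longrightarrow> u (x, t) = (\<Sum>k<n. h k x) * t"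
    unfolding poly_lt_def by blast
  \<comment> \<open>The truncated \<open>n - 1\<close> is harmless: for \<open>n = 0\<close> the sum
    is empty.\<close>
  have zero: "(\<Sum>k<n. \<bar>t\<bar> ^ k / t\<^sup>2 * lap (h k) \<xi> + (eigval \<gamma> d (n - 1) - eigval \<gamma> d k) * (h k \<xi> * \<bar>t\<bar> ^ k)) = 0"
  proof (cases n)
    case (Suc m)
    have "ball_integral \<gamma> (\<lambda>x. (\<Sum>k<Suc m. h k x) * q x) = 0" if q: "poly_lt m q" for q
    proof -
      have "(\<lambda>(x, t). q x * t ^ 1) \<in> cone_polys m"
        using poly_lt_cone_polys[OF q, of 1 m] by simp
      then have "cone_inner (\<lambda>t. \<bar>t\<bar> powr (-2) * (1 - t\<^sup>2) powr (\<gamma> - 1 / 2)) u (\<lambda>(x, t). q x * t) = 0"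
        using Suc by (intro orth[of m]) (auto simp: odd_in_t_def)
      then show ?thesis
        using cone_inner_odd[OF card, of u "\<lambda>x. \<Sum>k<Suc m. h k x" "\<lambda>(x, t). q x * t" q \<gamma>] u_eq Suc by simp
    qed
    from ball_operator_eigenfunction[OF \<gamma> card h this, of "\<bar>t\<bar> *\<^sub>R \<xi>"]
    have "(\<Sum>k<n. lap (h k) (\<bar>t\<bar> *\<^sub>R \<xi>) + (eigval \<gamma> d (n - 1) - eigval \<gamma> d k) * h k (\<bar>t\<bar> *\<^sub>R \<xi>)) = 0"
      using \<xi> t by (simp add: d_def Suc)
    then show ?thesis
      using t by (simp only: hpoly_lap_scaleR[OF h] hpoly_scaleR[OF h] abs_eq_0 not_False_eq_True power2_abs mult.commute[of "h _ \<xi>"])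
  qed simp
  have g: "g \<eta> s = (\<Sum>k<n. h k \<eta> * (\<bar>s\<bar> ^ k * s))" if "norm \<eta> = 1" "s \<in> {-1..1}" for \<eta> s
    using that unfolding g_def cone_coords_def
    by (subst u_eq) (auto simp: double_cone_def hpoly_scaleR[OF h] sum_distrib_left mult_ac)
  have dt: "d_dt g \<xi> s = (\<Sum>k<n. h k \<xi> * ((real k + 1) * \<bar>s\<bar> ^ k))" if s: "s \<noteq> 0" "s \<in> {-1..1}" for s
  proof (rule d_dt_eqI[OF s])
    show "g \<xi> r = (\<Sum>k<n. h k \<xi> * (\<bar>r\<bar> ^ k * r))" if "r \<in> {-1..1}" for r
      by (rule g[OF \<xi> that])
    have "((\<lambda>s. \<bar>s\<bar> ^ k * s) has_real_derivative (real k + 1) * \<bar>s\<bar> ^ k) (at s)" for k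
      by (rule DERIV_cong[OF DERIV_mult[OF DERIV_abs_power[OF s(1)] DERIV_ident]])
        (use s in \<open>simp add: field_simps\<close>)
    then show "((\<lambda>s. \<Sum>k<n. h k \<xi> * (\<bar>s\<bar> ^ k * s)) has_real_derivative
        (\<Sum>k<n. h k \<xi> * ((real k + 1) * \<bar>s\<bar> ^ k))) (at s)"
      by (intro DERIV_sum DERIV_cmult)
  qed
  have t_mem: "t \<in> {-1..1}"
    using t by simp
  have dtt: "d_dt (d_dt g) \<xi> t = (\<Sum>k<n. h k \<xi> * ((real k + 1) * (real k * \<bar>t\<bar> ^ k / t)))"
  proof (rule d_dt_eqI[where f = "\<lambda>s. \<Sum>k<n. h k \<xi> * ((real k + 1) * \<bar>s\<bar> ^ k)"])
    show "((\<lambda>s. \<Sum>k<n. h k \<xi> * ((real k + 1) * \<bar>s\<bar> ^ k)) has_real_derivative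
        (\<Sum>k<n. h k \<xi> * ((real k + 1) * (real k * \<bar>t\<bar> ^ k / t)))) (at t)"
      by (intro DERIV_sum DERIV_cmult DERIV_abs_power t)
  qed (use t dt in auto)
  have lb: "laplace_beltrami (\<lambda>\<eta>. g \<eta> t) \<xi> =
      (\<Sum>k<n. (\<bar>t\<bar> ^ k * t) * (lap (h k) \<xi> - real k * (real k + d - 2) * h k \<xi>))"
    unfolding d_def
    by (rule laplace_beltrami_sum[OF h \<xi>]) (use t in \<open>simp add: g mult.commute\<close>)
  \<comment> \<open>Passing the operator through the factor \<open>t\<close> gives the even one up
    to the constant \<open>-(2 \<gamma> + d - 2)\<close>, from \<open>t\<close> times the derivative
    of \<open>t\<close>. Accordingly \<open>n (n + 2 \<gamma> + d - 3)\<close> is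
    \<open>eigval \<gamma> d (n - 1) + (2 \<gamma> + d - 2)\<close>.\<close>
  have summand: "(1 - t\<^sup>2) * (h k \<xi> * ((real k + 1) * (real k * P / t)))
      - (2 * \<gamma> + d - 2) * t * (h k \<xi> * ((real k + 1) * P))
      + (d - 3) / t * (h k \<xi> * ((real k + 1) * P) - 1 / t * (h k \<xi> * (P * t)))
      + 1 / t\<^sup>2 * ((P * t) * (lap (h k) \<xi> - real k * (real k + d - 2) * h k \<xi>)) =
    t * (P / t\<^sup>2 * lap (h k) \<xi> + (eigval \<gamma> d (n - 1) - eigval \<gamma> d k) * (h k \<xi> * P))
      - real n * (real n + 2 * \<gamma> + d - 3) * (h k \<xi> * (P * t))" if "k < n" for k P
  proof -
    have e: "eigval \<gamma> d (n - 1) = (real n - 1) * (real n + 2 * \<gamma> + d - 2)"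
      using that by (simp add: eigval_def of_nat_diff)
    show ?thesis
      unfolding e eigval_def[of _ _ k] using t(1) by (simp add: field_simps power2_eq_square)
  qed
  have "(1 - t\<^sup>2) * d_dt (d_dt g) \<xi> t - (2 * \<gamma> + d - 2) * t * d_dt g \<xi> t
      + (d - 3) / t * (d_dt g \<xi> t - 1 / t * g \<xi> t) + 1 / t\<^sup>2 * laplace_beltrami (\<lambda>\<eta>. g \<eta> t) \<xi> =
    (\<Sum>k<n. t * (\<bar>t\<bar> ^ k / t\<^sup>2 * lap (h k) \<xi> + (eigval \<gamma> d (n - 1) - eigval \<gamma> d k) * (h k \<xi> * \<bar>t\<bar> ^ k))
      - real n * (real n + 2 * \<gamma> + d - 3) * (h k \<xi> * (\<bar>t\<bar> ^ k * t)))"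
    by (simp only: dtt dt[OF t(1) t_mem] lb g[OF \<xi> t_mem] sum_distrib_left sum.distrib[symmetric] sum_subtractf[symmetric])
      (intro sum.cong refl, simp only: summand lessThan_iff)
  also have "\<dots> = - real n * (real n + 2 * \<gamma> + d - 3) * g \<xi> t"
    using zero by (simp only: g[OF \<xi> t_mem] sum_subtractf sum_distrib_left[symmetric])
  finally show ?thesis .
qed

theorem theorem4p2:
  fixes d n :: nat and \<gamma> :: real
  assumes "d = CARD('n::finite)" and "d \<ge> 2" and "\<gamma> > - 1 / 2"
  shows "(\<forall>u \<in> (V_even n (\<lambda>t. (1 - t\<^sup>2) powr (\<gamma> - 1 / 2)) :: ((real ^ 'n) \<times> real \<Rightarrow> real) set).
            \<forall>\<xi> \<in> sphere 0 1. \<forall>t. t \<noteq> 0 \<and> -1 \<le> t \<and> t \<le> 1 \<longrightarrow>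
              (let g = cone_coords u in
                (1 - t\<^sup>2) * d_dt (d_dt g) \<xi> t
                - (2 * \<gamma> + real d) * t * d_dt g \<xi> t
                + (real d - 1) / t * d_dt g \<xi> t
                + 1 / t\<^sup>2 * laplace_beltrami (\<lambda>\<eta>. g \<eta> t) \<xi>
                = - real n * (real n + 2 * \<gamma> + real d - 1) * g \<xi> t))
       \<and> (\<forall>u \<in> (V_odd n (\<lambda>t. \<bar>t\<bar> powr (-2) * (1 - t\<^sup>2) powr (\<gamma> - 1 / 2)) :: ((real ^ 'n) \<times> real \<Rightarrow> real) set).
            \<forall>\<xi> \<in> sphere 0 1. \<forall>t. t \<noteq> 0 \<and> -1 \<le> t \<and> t \<le> 1 \<longrightarrow>
              (let g = cone_coords u in
                (1 - t\<^sup>2) * d_dt (d_dt g) \<xi> t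
                - (2 * \<gamma> + real d - 2) * t * d_dt g \<xi> t
                + (real d - 3) / t * (d_dt g \<xi> t - 1 / t * g \<xi> t)
                + 1 / t\<^sup>2 * laplace_beltrami (\<lambda>\<eta>. g \<eta> t) \<xi>
                = - real n * (real n + 2 * \<gamma> + real d - 3) * g \<xi> t))"
proof -
  have "CARD('n) \<ge> 2"
    using assms by simp
  note even_cone_equation[OF this assms(3)] odd_cone_equation[OF this assms(3)]
  then show ?thesis
    unfolding Let_def assms(1) by (intro conjI ballI allI impI; elim conjE; simp)
qed

end
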